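(* Let $n\ge 3$ be an integer and let $X_1,X_2,\ldots,X_n$ be independent, identically distributed positive random variables whose common distribution $F$ has a density $f$ that is positive and continuous on $(0,\infty)$. Let $X_{(1)}\le X_{(2)}\le\cdots\le X_{(n)}$ be the order statistics and $\overline{X}_n=\frac1n\sum_{i=1}^n X_i$ the sample mean. Let $(a_{ij})_{i,j=1}^n$ be a positive definite real matrix and define $$Z_n=\sum_{i=1}^n\sum_{j=1}^n a_{ij}\big(X_{(i)}-\overline{X}_n\big)\big(X_{(j)}-\overline{X}_n\big).$$ Then $\overline{X}_n$ and $(Z_n)^{1/2}/\overline{X}_n$ are independent if and only if $F$ is a gamma distribution.
   Context: A distribution $F$ is a gamma distribution if, for some $a>0$ and $b>0$, it is absolutely continuous with density $\frac{1}{\Gamma(a)b^a}x^{a-1}e^{-x/b}$ for $x>0$ and $0$ for $x\le 0$. *)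

theory Defs
  imports "HOL-Probability.Probability"
begin

definition gamma_density :: "real \<Rightarrow> real \<Rightarrow> real \<Rightarrow> real" where
  "gamma_density a b x =
     (if x > 0 then 1 / (Gamma a * b powr a) * x powr (a - 1) * exp (- x / b) else 0)"

definition gamma_distribution :: "real measure \<Rightarrow> bool" where
  "gamma_distribution F \<longleftrightarrow>
     (\<exists>a>0. \<exists>b>0. F = density lborel (\<lambda>x. ennreal (gamma_density a b x)))"

(* Samples and matrices are indexed by {1..n}; values at other indices are irrelevant. *)

definition sample_mean :: "nat \<Rightarrow> (nat \<Rightarrow> real) \<Rightarrow> real" where
  "sample_mean n x = (1 / real n) * (\<Sum>i=1..n. x i)"

(* The k-th smallest of x 1, ..., x n counted with multiplicity, for 1 <= k <= n. *)
definition order_statistic :: "nat \<Rightarrow> (nat \<Rightarrow> real) \<Rightarrow> nat \<Rightarrow> real" where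
  "order_statistic n x k = sort (map x [1..<Suc n]) ! (k - 1)"

(* Symmetry is not required, so symmetric positive definite matrices are a special case. *)
definition positive_definite :: "nat \<Rightarrow> (nat \<Rightarrow> nat \<Rightarrow> real) \<Rightarrow> bool" where
  "positive_definite n A \<longleftrightarrow>
     (\<forall>v :: nat \<Rightarrow> real. (\<exists>i\<in>{1..n}. v i \<noteq> 0) \<longrightarrow>
        (\<Sum>i=1..n. \<Sum>j=1..n. A i j * v i * v j) > 0)"

definition Z_statistic :: "nat \<Rightarrow> (nat \<Rightarrow> nat \<Rightarrow> real) \<Rightarrow> (nat \<Rightarrow> real) \<Rightarrow> real" where
  "Z_statistic n A x =
     (\<Sum>i=1..n. \<Sum>j=1..n. A i j * (order_statistic n x i - sample_mean n x)
                              * (order_statistic n x j - sample_mean n x))"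

end

theory Submission
  imports Defs
begin

text \<open>
  Write \<open>m\<close> for the sample mean and \<open>R = sqrt Z / m\<close>. Under \<open>y \<mapsto> c y\<close> with \<open>c > 0\<close> the
  mean scales by \<open>c\<close> while \<open>R\<close> does not change, so \<open>R\<close> is a function of the shape \<open>y / m\<close> only.

  Gamma implies independence. The density of a gamma sample with shape parameter \<open>a\<close> is a
  homogeneous function of \<open>y\<close> times a function of \<open>m\<close> alone. By scaling, the integral of the homogeneous factor over
  \<open>{m \<le> s, R \<in> B}\<close> is \<open>s powr (n * a)\<close> times its value at \<open>s = 1\<close>. Hence the measures on the line
  that arise for different \<open>B\<close> as laws of the mean are proportional, and multiplying by a
  function of \<open>m\<close> keeps them proportional. This is independence
  (\<open>gamma_product_independent\<close>).

  Independence implies gamma. Consider the event that \<open>R \<le> e\<close> with small \<open>e\<close> and that \<open>m\<close> lies in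
  a thin interval to the right of \<open>x\<close>: then all sample points are close to \<open>x\<close>. By independence
  its probability depends on \<open>e\<close> in the same way for all \<open>x\<close>; formally, a second order expansion
  in \<open>e\<close> turns this into \<open>x\<^sup>2 (ln f)'' = const\<close>, whose solutions \<open>a ln x + b x + c\<close> include the
  logarithms of all gamma densities. Since \<open>f\<close> is merely continuous, the differential equation is
  understood through one-sided comparison, in the manner of a maximum principle. Say that \<open>ln f\<close>
  is touched from above with exponent \<open>a\<close> if at some point it is dominated locally by a curve
  \<open>a ln x + b x + c\<close> of the same value there, and similarly from below.

  \<^item> Around a touching point, \<open>f\<close> is bounded by the exponential of the touching curve. The
    factor \<open>exp (b x)\<close> contributes only through \<open>m\<close>, and what remains is a multiple of the shape
    integral of \<open>(\<Prod>i. y i / m) powr a\<close> over \<open>R \<le> e\<close>. Under independence the dependence on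
    the event \<open>R \<le> e\<close> is the same at all points \<open>x\<close>. So if \<open>ln f\<close> is touched from above with
    exponent \<open>a\<close> at one point and from below with exponent \<open>a'\<close> at another, then the shape
    integral for \<open>a'\<close> is at most the one for \<open>a\<close>. As \<open>\<Prod>i. y i / m \<le> 1\<close> by the inequality of
    arithmetic and geometric means, the shape integral decreases strictly with the exponent,
    and \<open>a \<le> a'\<close> follows (\<open>touching_exponents_ordered_if_independent\<close>).
  \<^item> A continuous function for which every exponent of touching from above is at most every
    exponent of touching from below is of the form \<open>a ln x + b x + c\<close>
    (\<open>log_affine_if_touching_exponents_ordered\<close>): on each interval compare it with the curve
    of exponent \<open>a\<close> through its end points; an interior maximum or minimum of the difference
    is a touching point.

  Integrability then forces \<open>a > -1\<close> and \<open>b < 0\<close>, which is the gamma family.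
\<close>

\<comment> \<open>Index ranges should keep the form \<open>{1..n}\<close> under simplification.\<close>
declare One_nat_def [simp del]

section \<open>Curves touched by logarithms of gamma densities\<close>

text \<open>
  The height of the graph of \<open>h\<close> above its chord over \<open>[p, q]\<close>. The quotient is kept as one factor
  so that linearity in \<open>h\<close> is visible even for \<open>p = q\<close>.
\<close>

definition chord_gap :: "(real \<Rightarrow> real) \<Rightarrow> real \<Rightarrow> real \<Rightarrow> real \<Rightarrow> real" where
  "chord_gap h p q x = h x - (h p + (h q - h p) * ((x - p) / (q - p)))"

lemma chord_gap_endpoints:
  "chord_gap h p q p = 0" "p < q \<Longrightarrow> chord_gap h p q q = 0"
  by (auto simp: chord_gap_def)

lemma chord_gap_linear:
  "chord_gap (\<lambda>x. h x - a * k x) p q x = chord_gap h p q x - a * chord_gap k p q x"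
proof -
  define s where "s = (x - p) / (q - p)"
  show ?thesis unfolding chord_gap_def s_def[symmetric] by (simp add: algebra_simps)
qed

lemma chord_gap_uminus: "chord_gap (\<lambda>x. - h x) p q x = - chord_gap h p q x"
proof -
  define s where "s = (x - p) / (q - p)"
  show ?thesis unfolding chord_gap_def s_def[symmetric] by (simp add: algebra_simps)
qed

text \<open>
  Strict concavity of the logarithm, from \<open>ln u < u - 1\<close> applied at \<open>p / x\<close> and \<open>q / x\<close>; the two
  right-hand sides cancel in the convex combination that yields \<open>x\<close>.
\<close>

lemma chord_gap_ln_pos:
  assumes "0 < p" "p < x" "x < q"
  shows "chord_gap ln p q x > 0"
proof -
  have 1: "ln p - ln x < p / x - 1"
  proof -
    have "ln (p / x) \<le> p / x - 1" using assms by (intro ln_le_minus_one) auto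
    moreover have "ln (p / x) \<noteq> p / x - 1" using assms ln_eq_minus_one[of "p / x"] by auto
    ultimately show ?thesis using assms by (simp add: ln_div)
  qed
  have 2: "ln q - ln x < q / x - 1"
  proof -
    have "ln (q / x) \<le> q / x - 1" using assms by (intro ln_le_minus_one) auto
    moreover have "ln (q / x) \<noteq> q / x - 1" using assms ln_eq_minus_one[of "q / x"] by auto
    ultimately show ?thesis using assms by (simp add: ln_div)
  qed
  have 3: "(ln p - ln x) * (q - x) < (p / x - 1) * (q - x)" using 1 assms by (intro mult_strict_right_mono) auto
  have 4: "(ln q - ln x) * (x - p) < (q / x - 1) * (x - p)" using 2 assms by (intro mult_strict_right_mono) auto
  have 5: "(p / x - 1) * (q - x) + (q / x - 1) * (x - p) = 0" using assms by (simp add: field_simps)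
  have "(q - p) * chord_gap ln p q x = - ((ln p - ln x) * (q - x) + (ln q - ln x) * (x - p))"
    using assms unfolding chord_gap_def by (simp add: field_simps)
  also have "\<dots> > 0" using 3 4 5 by linarith
  finally show ?thesis using assms by (simp add: zero_less_mult_iff)
qed

text \<open>
  The increment is measured in the relative variable \<open>t\<close>, so that the additive constant of the
  touching curve \<open>a ln x + b x + c\<close> drops out. Touching from below with exponent \<open>a\<close> is expressed
  as \<open>touched_above (\<lambda>x. - L x) (- a)\<close>.
\<close>

definition touched_above :: "(real \<Rightarrow> real) \<Rightarrow> real \<Rightarrow> bool" where
  "touched_above L a \<longleftrightarrow> (\<exists>b x r. 0 < x \<and> 0 < r \<and>
     (\<forall>t. \<bar>t - 1\<bar> \<le> r \<longrightarrow> L (x * t) - L x \<le> b * (t - 1) + a * ln t))"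

text \<open>
  Subtract from \<open>L\<close> the curve of exponent \<open>a\<close> that agrees with it at \<open>p\<close> and \<open>q\<close>. The difference
  vanishes at the end points and is positive at \<open>y\<close>, so its maximum is interior, and there a
  translate of the curve touches \<open>L\<close> from above.
\<close>

lemma touched_above_if_chord_gap:
  assumes L: "continuous_on {0<..} L" and p: "0 < p" and y: "p < y" "y < q"
    and gap: "chord_gap L p q y > a * chord_gap ln p q y"
  shows "touched_above L a"
proof -
  define h where "h = chord_gap (\<lambda>x. L x - a * ln x) p q"
  have "continuous_on {p..q} h"
    unfolding h_def chord_gap_def using p y
    by (intro continuous_intros continuous_on_subset[OF L]) auto
  then obtain x where x: "x \<in> {p..q}" and max: "\<And>z. z \<in> {p..q} \<Longrightarrow> h z \<le> h x"
    using continuous_attains_sup[of "{p..q}" h] y by auto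
  have "h y > 0" using gap by (simp add: h_def chord_gap_linear)
  hence hx: "h x > 0" using max[of y] y by auto
  hence xpq: "p < x" "x < q"
    using x chord_gap_endpoints(1)[of "\<lambda>x. L x - a * ln x" p q]
      chord_gap_endpoints(2)[of p q "\<lambda>x. L x - a * ln x"] y
    unfolding h_def by (auto simp: less_le)
  define s where "s = ((L q - a * ln q) - (L p - a * ln p)) / (q - p)"
  define r where "r = min (x - p) (q - x) / x"
  have r0: "r > 0" using xpq p by (auto simp: r_def)
  \<comment> \<open>The slope \<open>s\<close> of the chord in the variable \<open>x * t\<close> becomes \<open>s * x\<close> in the variable \<open>t\<close>.\<close>
  have "L (x * t) - L x \<le> (s * x) * (t - 1) + a * ln t" if t: "\<bar>t - 1\<bar> \<le> r" for t
  proof -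
    have x0: "x > 0" using xpq p by auto
    have "\<bar>x * t - x\<bar> \<le> x * r" using t x0
      by (metis (no_types, opaque_lifting) abs_mult abs_of_pos mult.right_neutral mult_left_mono less_imp_le right_diff_distrib)
    also have "x * r = min (x - p) (q - x)" using x0 by (simp add: r_def)
    finally have xt: "p \<le> x * t" "x * t \<le> q" by linarith+
    hence t0: "t > 0" using p x0 by (smt (verit) mult_nonneg_nonpos)
    have "h (x * t) \<le> h x" using max xt by auto
    hence "L (x * t) - a * ln (x * t) - s * (x * t - p) \<le> L x - a * ln x - s * (x - p)"
      by (simp add: h_def chord_gap_def s_def)
    thus ?thesis using x0 t0 by (simp add: ln_mult algebra_simps)
  qed
  with xpq p r0 show ?thesis unfolding touched_above_def by (intro exI[of _ "s * x"] exI[of _ x] exI[of _ r]) auto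
qed

lemma affine_if_chord_gap_zero:
  assumes gap: "\<And>p q x. 0 < p \<Longrightarrow> p < x \<Longrightarrow> x < q \<Longrightarrow> chord_gap h p q x = 0"
  shows "\<exists>b c. \<forall>x>0. h x = b * x + c"
proof (intro exI allI impI)
  have *: "(h x - h p) * (q - p) = (h q - h p) * (x - p)" if "0 < p" "p < x" "x < q" for p q x
    using gap[OF that] that unfolding chord_gap_def by (simp add: field_simps)
  fix x :: real assume x: "0 < x"
  consider "x < 1" | "x = 1" | "1 < x" "x < 2" | "x = 2" | "x > 2" by linarith
  thus "h x = (h 2 - h 1) * x + (2 * h 1 - h 2)"
  proof cases
    case 1 
    have "(2 - x) * h 1 = h x * 1 + (1 - x) * h 2" 
      using *[of x 1 2] x 1 by (simp add: algebra_simps)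
    thus ?thesis by (simp add: algebra_simps)
  next
    case 3 thus ?thesis using *[of 1 x 2] by (simp add: algebra_simps)
  next
    case 5 thus ?thesis using *[of 1 2 x] by (simp add: algebra_simps)
  qed (auto simp: algebra_simps)
qed

text \<open>
  If the quotient of the chord gaps of \<open>L\<close> and of \<open>ln\<close> took two different values, then two exponents
  \<open>b < a\<close> strictly between them would occur, \<open>a\<close> for touching from above and \<open>b\<close> for touching from
  below. So this quotient is a constant \<open>a\<close>, and \<open>L x - a ln x\<close> has no chord gap at all.
\<close>

lemma log_affine_if_touching_exponents_ordered:
  assumes L: "continuous_on {0<..} L"
    and order: "\<And>a b. touched_above L a \<Longrightarrow> touched_above (\<lambda>x. - L x) (- b) \<Longrightarrow> a \<le> b"
  shows "\<exists>a b c. \<forall>x>0. L x = a * ln x + b * x + c"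
proof -
  define ratio where "ratio p q x = chord_gap L p q x / chord_gap ln p q x" for p q x
  have le: "ratio p q x \<le> ratio p' q' x'"
    if "0 < p" "p < x" "x < q" "0 < p'" "p' < x'" "x' < q'" for p q x p' q' x'
  proof (rule ccontr)
    assume "\<not> ?thesis"
    then obtain a b where ab: "ratio p' q' x' < b" "b < a" "a < ratio p q x"
      by (meson dense not_le)
    have "touched_above L a"
      using touched_above_if_chord_gap[OF L that(1-3)] ab(3) chord_gap_ln_pos[OF that(1-3)]
      by (simp add: ratio_def field_simps)
    moreover have "touched_above (\<lambda>x. - L x) (- b)"
      using touched_above_if_chord_gap[of "\<lambda>x. - L x", OF _ that(4-6)] L ab(1) chord_gap_ln_pos[OF that(4-6)]
      by (simp add: ratio_def field_simps chord_gap_uminus continuous_on_minus)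
    ultimately have "a \<le> b" by (rule order)
    with ab show False by simp
  qed
  define a where "a = ratio 1 3 2"
  have "chord_gap (\<lambda>x. L x - a * ln x) p q x = 0" if "0 < p" "p < x" "x < q" for p q x
  proof -
    have "ratio p q x = a" using le[of p x q 1 2 3] le[of 1 2 3 p x q] that by (simp add: a_def)
    thus ?thesis using chord_gap_ln_pos[OF that] by (simp add: chord_gap_linear ratio_def field_simps)
  qed
  from affine_if_chord_gap_zero[OF this] obtain b c where "\<forall>x>0. L x - a * ln x = b * x + c" by blast
  thus ?thesis by (intro exI[of _ a] exI[of _ b] exI[of _ c]) (auto simp: algebra_simps)
qed

section \<open>Order statistics and the quadratic form\<close>

lemma sample_mean_cong:
  "(\<And>i. i \<in> {1..n} \<Longrightarrow> x i = y i) \<Longrightarrow> sample_mean n x = sample_mean n y"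
  unfolding sample_mean_def by (auto intro!: arg_cong2[where f = "(*)"] sum.cong)

lemma order_statistic_cong:
  assumes "\<And>i. i \<in> {1..n} \<Longrightarrow> x i = y i"
  shows "order_statistic n x k = order_statistic n y k"
proof -
  have "map x [1..<Suc n] = map y [1..<Suc n]" using assms by (intro map_cong) auto
  thus ?thesis by (simp only: order_statistic_def)
qed

lemma Z_statistic_cong:
  assumes "\<And>i. i \<in> {1..n} \<Longrightarrow> x i = y i"
  shows "Z_statistic n A x = Z_statistic n A y"
  unfolding Z_statistic_def
  using sample_mean_cong[of n x y, OF assms] order_statistic_cong[of n x y, OF assms] by simp

lemma sample_mean_scale: "sample_mean n (\<lambda>i. c * x i) = c * sample_mean n x"
  by (simp add: sample_mean_def sum_distrib_left ac_simps)

lemma order_statistic_scale: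
  assumes "c > 0" "k \<in> {1..n}"
  shows "order_statistic n (\<lambda>i. c * x i) k = c * order_statistic n x k"
proof -
  let ?xs = "map x [1..<Suc n]"
  have "sort (map ((*) c) ?xs) = map ((*) c) (sort ?xs)"
  proof (rule properties_for_sort)
    show "mset (map ((*) c) (sort ?xs)) = mset (map ((*) c) ?xs)" by (simp only: mset_map mset_sort)
    show "sorted (map ((*) c) (sort ?xs))"
      using assms by (auto simp: sorted_map intro!: sorted_wrt_mono_rel[OF _ sorted_sort])
  qed
  moreover have "map (\<lambda>i. c * x i) [1..<Suc n] = map ((*) c) ?xs" by simp
  ultimately have "sort (map (\<lambda>i. c * x i) [1..<Suc n]) = map ((*) c) (sort ?xs)" by metis
  moreover have "k - 1 < length (sort ?xs)" using assms by auto
  ultimately show ?thesis unfolding order_statistic_def by (simp only: nth_map)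
qed

lemma Z_statistic_scale:
  assumes "c > 0"
  shows "Z_statistic n A (\<lambda>i. c * x i) = c\<^sup>2 * Z_statistic n A x"
  unfolding Z_statistic_def sum_distrib_left sample_mean_scale
  using order_statistic_scale[OF assms]
  by (intro sum.cong refl) (simp add: power2_eq_square algebra_simps)

lemma order_statistic_attained:
  assumes "k \<in> {1..n}"
  shows "\<exists>i\<in>{1..n}. order_statistic n x k = x i"
proof -
  have "order_statistic n x k \<in> set (sort (map x [1..<Suc n]))"
    unfolding order_statistic_def using assms by (intro nth_mem) auto
  thus ?thesis by (auto simp del: upt_Suc)
qed

lemma attained_by_order_statistic:
  assumes "i \<in> {1..n}"
  shows "\<exists>k\<in>{1..n}. x i = order_statistic n x k"
proof -
  have "x i \<in> set (sort (map x [1..<Suc n]))" using assms by (auto simp del: upt_Suc)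
  then obtain j where "j < n" "x i = sort (map x [1..<Suc n]) ! j"
    by (metis in_set_conv_nth length_sort length_map length_upt diff_Suc_1)
  thus ?thesis by (intro bexI[of _ "Suc j"]) (auto simp: order_statistic_def)
qed

text \<open>
  Expresses order statistics by counting the sample points up to \<open>t\<close>; the count is a finite sum of
  indicators, which makes measurability immediate.
\<close>

lemma order_statistic_le_iff:
  assumes "k \<in> {1..n}"
  shows "order_statistic n x k \<le> t \<longleftrightarrow> real k \<le> (\<Sum>i=1..n. indicator {..t} (x i))"
proof -
  define ys where "ys = sort (map x [1..<Suc n])"
  have len: "length ys = n" and srt: "sorted ys" by (auto simp: ys_def)
  define J where "J = {j. j < n \<and> ys ! j \<le> t}"
  have "(\<Sum>i=1..n. indicator {..t} (x i)) = real (length (filter (\<lambda>y. y \<le> t) (map x [1..<Suc n])))"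
    by (induction n) (auto simp: indicator_def)
  also have "length (filter (\<lambda>y. y \<le> t) (map x [1..<Suc n])) = length (filter (\<lambda>y. y \<le> t) ys)"
    unfolding ys_def by (metis mset_filter mset_sort size_mset)
  also have "\<dots> = card J" by (simp add: length_filter_conv_card len J_def)
  finally have eq: "(\<Sum>i=1..n. indicator {..t} (x i)) = real (card J)" .
  have fin: "finite J" by (simp add: J_def)
  have "ys ! (k - 1) \<le> t \<longleftrightarrow> k \<le> card J"
  proof
    assume le: "ys ! (k - 1) \<le> t"
    have "{..<k} \<subseteq> J"
    proof
      fix j assume "j \<in> {..<k}"
      hence "j \<le> k - 1" "k - 1 < n" using assms by auto
      with srt len le show "j \<in> J" unfolding J_def by (auto dest: sorted_nth_mono)
    qed
    from card_mono[OF fin this] show "k \<le> card J" by simp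
  next
    assume le: "k \<le> card J"
    show "ys ! (k - 1) \<le> t"
    proof (rule ccontr)
      assume gt: "\<not> ys ! (k - 1) \<le> t"
      have "J \<subseteq> {..<k - 1}"
      proof
        fix j assume j: "j \<in> J"
        show "j \<in> {..<k - 1}"
        proof (rule ccontr)
          assume "j \<notin> {..<k - 1}"
          with sorted_nth_mono[OF srt, of "k - 1" j] j len gt
          show False by (auto simp: J_def)
        qed
      qed
      from card_mono[OF _ this] have "card J \<le> k - 1" by simp
      moreover have "k \<ge> 1" using assms by simp
      ultimately show False using le by linarith
    qed
  qed
  thus ?thesis unfolding order_statistic_def eq ys_def by simp
qed

lemma measurable_sample_mean [measurable]:
  "sample_mean n \<in> borel_measurable (\<Pi>\<^sub>M i\<in>{1..n}. borel)"
  unfolding sample_mean_def by measurable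

lemma measurable_order_statistic:
  assumes "k \<in> {1..n}"
  shows "(\<lambda>x. order_statistic n x k) \<in> borel_measurable (\<Pi>\<^sub>M i\<in>{1..n}. borel)"
proof (rule borel_measurableI_le)
  fix t :: real
  have "{x \<in> space (\<Pi>\<^sub>M i\<in>{1..n}. borel). real k \<le> (\<Sum>i=1..n. indicator {..t} (x i))}
      \<in> sets (\<Pi>\<^sub>M i\<in>{1..n}. borel)" by measurable
  thus "{x \<in> space (\<Pi>\<^sub>M i\<in>{1..n}. borel). order_statistic n x k \<le> t} \<in> sets (\<Pi>\<^sub>M i\<in>{1..n}. borel)"
    by (simp only: order_statistic_le_iff[OF assms])
qed

lemma measurable_Z_statistic [measurable]:
  "Z_statistic n A \<in> borel_measurable (\<Pi>\<^sub>M i\<in>{1..n}. borel)"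
  unfolding Z_statistic_def using measurable_order_statistic[of _ n]
  by (intro borel_measurable_sum borel_measurable_times borel_measurable_diff measurable_sample_mean) auto

text \<open>
  Compactness of the unit sphere of the maximum norm: the quadratic form attains a positive
  minimum there, and homogeneity does the rest.
\<close>

lemma positive_definite_coercive:
  assumes A: "positive_definite n A" and n: "n > 0"
  shows "\<exists>l>0. \<forall>v. \<forall>k\<in>{1..n}. l * (v k)\<^sup>2 \<le> (\<Sum>i=1..n. \<Sum>j=1..n. A i j * v i * v j)"
proof -
  define q :: "(nat \<Rightarrow> real) \<Rightarrow> real" where "q v = (\<Sum>i=1..n. \<Sum>j=1..n. A i j * v i * v j)" for v
  \<comment> \<open>Coordinates outside \<open>{1..n}\<close> are pinned to 0, so that the cube is compact in the product topology.\<close>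
  define K :: "(nat \<Rightarrow> real) set" where "K = (\<Pi>\<^sub>E i\<in>UNIV. if i \<in> {1..n} then {-1..1} else {0})"
  have K_iff: "v \<in> K \<longleftrightarrow> (\<forall>i. (i \<in> {1..n} \<longrightarrow> \<bar>v i\<bar> \<le> 1) \<and> (i \<notin> {1..n} \<longrightarrow> v i = 0))" for v
    unfolding K_def by (auto simp: PiE_iff abs_le_iff split: if_splits)
  have "compactin (product_topology (\<lambda>_. euclidean) UNIV) K"
    unfolding K_def compactin_PiE by auto
  hence "compact K" by (simp add: euclidean_product_topology)
  define U where "U = (\<Union>k\<in>{1..n}. {v \<in> K. \<bar>v k\<bar> = 1})"
  have "compact U" unfolding U_def
  proof (intro compact_UN)
    fix k assume "k \<in> {1..n}"
    have "closed {v :: nat \<Rightarrow> real. \<bar>v k\<bar> = 1}" by (intro closed_Collect_eq continuous_intros) auto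
    moreover have "{v \<in> K. \<bar>v k\<bar> = 1} = K \<inter> {v. \<bar>v k\<bar> = 1}" by auto
    ultimately show "compact {v \<in> K. \<bar>v k\<bar> = 1}"
      using compact_Int_closed[OF \<open>compact K\<close>] by metis
  qed auto
  moreover have "(\<lambda>i. if i = 1 then 1 else 0) \<in> U" using n by (auto simp: U_def K_iff intro!: bexI[of _ 1])
  moreover have "continuous_on U q" unfolding q_def
    by (intro continuous_intros continuous_on_subset[OF continuous_on_product_coordinates]) auto
  ultimately obtain w where w: "w \<in> U" "\<And>v. v \<in> U \<Longrightarrow> q w \<le> q v"
    using continuous_attains_inf[of U q] by auto
  obtain k where "k \<in> {1..n}" "\<bar>w k\<bar> = 1" using w(1) unfolding U_def by blast
  hence "\<exists>k\<in>{1..n}. w k \<noteq> 0" by (intro bexI[of _ k]) auto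
  with A have qw: "q w > 0" unfolding q_def positive_definite_def by blast
  have "q w * (v k)\<^sup>2 \<le> q v" if k: "k \<in> {1..n}" for v k
  proof -
    define m where "m = Max ((\<lambda>i. \<bar>v i\<bar>) ` {1..n})"
    have m: "\<bar>v i\<bar> \<le> m" if "i \<in> {1..n}" for i using that by (auto simp: m_def)
    have "m \<in> (\<lambda>i. \<bar>v i\<bar>) ` {1..n}" unfolding m_def using n by (intro Max_in) auto
    then obtain l where l: "l \<in> {1..n}" "\<bar>v l\<bar> = m" by auto
    show ?thesis
    proof (cases "m = 0")
      case True
      hence "\<forall>i\<in>{1..n}. v i = 0" using m by fastforce
      with k show ?thesis by (simp add: q_def)
    next
      case False
      hence m0: "m > 0" using l by auto
      define u where "u i = (if i \<in> {1..n} then v i / m else 0)" for i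
      have "u \<in> U" unfolding U_def using m m0 l by (auto simp: K_iff u_def abs_divide intro!: bexI[of _ l])
      hence "q w \<le> q u" by (rule w)
      also have "q u = q v / m\<^sup>2"
        unfolding q_def sum_divide_distrib by (intro sum.cong refl) (auto simp: u_def power2_eq_square)
      finally have "q w * m\<^sup>2 \<le> q v" using m0 by (simp add: field_simps)
      moreover have "(v k)\<^sup>2 \<le> m\<^sup>2" using m[OF k] by (metis abs_ge_zero power2_abs power_mono)
      ultimately show ?thesis using qw by (meson less_imp_le mult_left_mono order_trans)
    qed
  qed
  with qw show ?thesis unfolding q_def by blast
qed

text \<open>
  Every sample point is one of the order statistics, so the deviation of each single point is
  controlled by the quadratic form although the form does not see the labels.
\<close>

lemma Z_statistic_coercive:
  assumes A: "positive_definite n A" and n: "n > 0"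
  shows "\<exists>l>0. \<forall>x. \<forall>i\<in>{1..n}. l * (x i - sample_mean n x)\<^sup>2 \<le> Z_statistic n A x"
proof -
  obtain l where l: "l > 0"
    "\<And>v k. k \<in> {1..n} \<Longrightarrow> l * (v k)\<^sup>2 \<le> (\<Sum>i=1..n. \<Sum>j=1..n. A i j * v i * v j)"
    using positive_definite_coercive[OF A n] by blast
  have "l * (x i - sample_mean n x)\<^sup>2 \<le> Z_statistic n A x" if i: "i \<in> {1..n}" for x i
  proof -
    obtain k where k: "k \<in> {1..n}" "x i = order_statistic n x k"
      using attained_by_order_statistic[OF i] by blast
    show ?thesis unfolding Z_statistic_def k(2)
      using l(2)[OF k(1), of "\<lambda>i. order_statistic n x i - sample_mean n x"] .
  qed
  with l(1) show ?thesis by blast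
qed

text \<open>
  Every order statistic is one of the sample points and inherits their deviation bound.
\<close>

lemma Z_statistic_bounded:
  assumes dev: "\<And>i. i \<in> {1..n} \<Longrightarrow> \<bar>x i - sample_mean n x\<bar> \<le> d"
  shows "Z_statistic n A x \<le> (\<Sum>i=1..n. \<Sum>j=1..n. \<bar>A i j\<bar>) * d\<^sup>2"
  unfolding Z_statistic_def sum_distrib_right
proof (intro sum_mono)
  fix i j assume ij: "i \<in> {1..n}" "j \<in> {1..n}"
  let ?v = "\<lambda>i. order_statistic n x i - sample_mean n x"
  have dev': "\<bar>?v k\<bar> \<le> d" if "k \<in> {1..n}" for k
    using order_statistic_attained[OF that, of x] dev by auto
  have "A i j * ?v i * ?v j \<le> \<bar>A i j\<bar> * (\<bar>?v i\<bar> * \<bar>?v j\<bar>)"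
    by (metis abs_ge_self abs_mult mult.assoc)
  also have "\<dots> \<le> \<bar>A i j\<bar> * (d * d)"
    using dev'[OF ij(1)] dev'[OF ij(2)] by (intro mult_left_mono mult_mono) auto
  finally show "A i j * ?v i * ?v j \<le> \<bar>A i j\<bar> * d\<^sup>2" by (simp add: power2_eq_square)
qed

section \<open>Product Lebesgue measure, scaling and iid samples\<close>

abbreviation lborel_n :: "nat \<Rightarrow> (nat \<Rightarrow> real) measure" where
  "lborel_n n \<equiv> \<Pi>\<^sub>M i\<in>{1..n}. lborel"

lemma emeasure_lborel_scale:
  assumes "c > 0" and [measurable]: "A \<in> sets borel"
  shows "emeasure lborel A = ennreal c * emeasure lborel {x. c * x \<in> A}"
proof -
  have "emeasure lborel A = (\<integral>\<^sup>+x. indicator A x \<partial>lborel)" by simp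
  also have "\<dots> = ennreal c * (\<integral>\<^sup>+x. indicator A (0 + c * x) \<partial>lborel)"
    using assms(1) by (subst nn_integral_real_affine[of _ c 0]) auto
  also have "(\<integral>\<^sup>+x. indicator A (0 + c * x) \<partial>lborel) = (\<integral>\<^sup>+x. indicator {x. c * x \<in> A} x \<partial>lborel)"
    by (intro nn_integral_cong) (auto simp: indicator_def)
  also have "\<dots> = emeasure lborel {x. c * x \<in> A}" by (intro nn_integral_indicator) simp
  finally show ?thesis .
qed

text \<open>
  The result of scaling is restricted to \<open>I\<close> again because elements of the product space have the
  default value outside the index set.
\<close>

lemma nn_integral_PiM_lborel_scale:
  fixes h :: "('i \<Rightarrow> real) \<Rightarrow> ennreal"
  assumes c: "c > 0" and I: "finite I" and h: "h \<in> borel_measurable (\<Pi>\<^sub>M i\<in>I. lborel)"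
  shows "(\<integral>\<^sup>+y. h y \<partial>(\<Pi>\<^sub>M i\<in>I. lborel)) =
    ennreal c ^ card I * (\<integral>\<^sup>+y. h (\<lambda>i\<in>I. c * y i) \<partial>(\<Pi>\<^sub>M i\<in>I. lborel))"
proof -
  interpret product_sigma_finite "\<lambda>_::'i. lborel :: real measure" by standard
  let ?N = "\<Pi>\<^sub>M i\<in>I. lborel :: real measure"
  let ?s = "\<lambda>y. \<lambda>i\<in>I. c * y i"
  have s [measurable]: "?s \<in> ?N \<rightarrow>\<^sub>M ?N" by measurable
  have "density (distr ?N ?N ?s) (\<lambda>_. ennreal c ^ card I) = ?N"
  proof (rule PiM_eqI[OF I])
    fix A :: "'i \<Rightarrow> real set" assume "\<And>i. i \<in> I \<Longrightarrow> A i \<in> sets lborel"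
    hence A: "A i \<in> sets borel" if "i \<in> I" for i using that by simp
    have [measurable]: "Pi\<^sub>E I A \<in> sets ?N" using A I by (intro sets_PiM_I_finite) auto
    have "emeasure (density (distr ?N ?N ?s) (\<lambda>_. ennreal c ^ card I)) (Pi\<^sub>E I A)
        = ennreal c ^ card I * emeasure ?N (?s -` Pi\<^sub>E I A \<inter> space ?N)"
      by (simp add: emeasure_density nn_integral_cmult_indicator emeasure_distr)
    also have "?s -` Pi\<^sub>E I A \<inter> space ?N = (\<Pi>\<^sub>E i\<in>I. {x. c * x \<in> A i})"
      by (auto simp: space_PiM PiE_iff)
    also have "emeasure ?N \<dots> = (\<Prod>i\<in>I. emeasure lborel {x. c * x \<in> A i})"
      using I A by (intro emeasure_PiM) (auto intro!: measurable_sets_borel[of "\<lambda>x. c * x" borel, simplified vimage_def])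
    also have "ennreal c ^ card I * \<dots> = (\<Prod>i\<in>I. ennreal c * emeasure lborel {x. c * x \<in> A i})"
      by (simp add: prod.distrib)
    also have "\<dots> = (\<Prod>i\<in>I. emeasure lborel (A i))"
      using emeasure_lborel_scale[OF c A] by (intro prod.cong) auto
    finally show "emeasure (density (distr ?N ?N ?s) (\<lambda>_. ennreal c ^ card I)) (Pi\<^sub>E I A)
        = (\<Prod>i\<in>I. emeasure lborel (A i))" .
  qed simp
  hence "(\<integral>\<^sup>+y. h y \<partial>?N) = (\<integral>\<^sup>+y. h y \<partial>density (distr ?N ?N ?s) (\<lambda>_. ennreal c ^ card I))" by simp
  also have "\<dots> = ennreal c ^ card I * (\<integral>\<^sup>+y. h (?s y) \<partial>?N)"
    using h s by (simp add: nn_integral_density nn_integral_distr nn_integral_cmult)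
  finally show ?thesis .
qed

lemma PiM_density_lborel:
  fixes I :: "'i set" and g :: "real \<Rightarrow> ennreal"
  assumes I: "finite I" and g [measurable]: "g \<in> borel_measurable borel"
    and prob: "prob_space (density lborel g)"
  shows "(\<Pi>\<^sub>M i\<in>I. density lborel g) = density (\<Pi>\<^sub>M i\<in>I. lborel) (\<lambda>y. \<Prod>i\<in>I. g (y i))"
proof -
  interpret L: product_sigma_finite "\<lambda>_::'i. lborel :: real measure" by standard
  interpret P: prob_space "density lborel g" by fact
  interpret G: product_sigma_finite "\<lambda>_::'i. density lborel g" by standard
  let ?N = "\<Pi>\<^sub>M i\<in>I. lborel :: real measure"
  show ?thesis
  proof (rule G.PiM_eqI[OF I, symmetric])
    show "sets (density ?N (\<lambda>y. \<Prod>i\<in>I. g (y i))) = sets (\<Pi>\<^sub>M i\<in>I. density lborel g)"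
      by (simp cong: sets_PiM_cong)
    fix A :: "'i \<Rightarrow> real set" assume "\<And>i. i \<in> I \<Longrightarrow> A i \<in> sets (density lborel g)"
    hence A: "A i \<in> sets borel" if "i \<in> I" for i using that by simp
    have prod_meas: "(\<lambda>y. \<Prod>i\<in>I. g (y i)) \<in> borel_measurable ?N" by measurable
    have meas: "Pi\<^sub>E I A \<in> sets ?N" using A I by (intro sets_PiM_I_finite) auto
    have "emeasure (density ?N (\<lambda>y. \<Prod>i\<in>I. g (y i))) (Pi\<^sub>E I A)
        = (\<integral>\<^sup>+y. (\<Prod>i\<in>I. g (y i)) * indicator (Pi\<^sub>E I A) y \<partial>?N)"
      by (rule emeasure_density[OF prod_meas meas])
    also have "\<dots> = (\<integral>\<^sup>+y. (\<Prod>i\<in>I. g (y i) * indicator (A i) (y i)) \<partial>?N)"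
    proof (intro nn_integral_cong)
      fix y assume "y \<in> space ?N"
      hence "indicator (Pi\<^sub>E I A) y = (\<Prod>i\<in>I. indicator (A i) (y i) :: ennreal)"
        using I by (auto simp: space_PiM PiE_iff indicator_def prod_zero_iff intro!: prod.neutral)
      thus "(\<Prod>i\<in>I. g (y i)) * indicator (Pi\<^sub>E I A) y = (\<Prod>i\<in>I. g (y i) * indicator (A i) (y i))"
        by (simp add: prod.distrib)
    qed
    also have "\<dots> = (\<Prod>i\<in>I. \<integral>\<^sup>+x. g x * indicator (A i) x \<partial>lborel)"
      using A by (intro L.product_nn_integral_prod[OF I]) auto
    also have "\<dots> = (\<Prod>i\<in>I. emeasure (density lborel g) (A i))"
      using A by (intro prod.cong refl) (simp add: emeasure_density)
    finally show "emeasure (density ?N (\<lambda>y. \<Prod>i\<in>I. g (y i))) (Pi\<^sub>E I A)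
        = (\<Prod>i\<in>I. emeasure (density lborel g) (A i))" .
  qed
qed

definition root_Z_over_mean :: "nat \<Rightarrow> (nat \<Rightarrow> nat \<Rightarrow> real) \<Rightarrow> (nat \<Rightarrow> real) \<Rightarrow> real" where
  "root_Z_over_mean n A y = sqrt (Z_statistic n A y) / sample_mean n y"

lemma measurable_root_Z_over_mean [measurable]:
  "root_Z_over_mean n A \<in> borel_measurable (\<Pi>\<^sub>M i\<in>{1..n}. borel)"
  unfolding root_Z_over_mean_def by measurable

lemma sample_mean_restrict_scale:
  "sample_mean n (\<lambda>i\<in>{1..n}. c * y i) = c * sample_mean n y"
  unfolding sample_mean_scale[symmetric] by (rule sample_mean_cong) auto

lemma root_Z_over_mean_restrict_scale:
  assumes "c > 0"
  shows "root_Z_over_mean n A (\<lambda>i\<in>{1..n}. c * y i) = root_Z_over_mean n A y"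
proof -
  have "Z_statistic n A (\<lambda>i\<in>{1..n}. c * y i) = Z_statistic n A (\<lambda>i. c * y i)"
    by (rule Z_statistic_cong) auto
  thus ?thesis using assms
    by (simp add: root_Z_over_mean_def sample_mean_restrict_scale Z_statistic_scale real_sqrt_mult)
qed

text \<open>
  The substitution \<open>y \<mapsto> s y\<close> has Jacobian \<open>s ^ n\<close> and multiplies \<open>h\<close> by \<open>s powr d\<close>.
\<close>

lemma nn_integral_homogeneous_sample_mean_le:
  assumes h [measurable]: "h \<in> borel_measurable (lborel_n n)"
    and hom: "\<And>c y. c > 0 \<Longrightarrow> h (\<lambda>i\<in>{1..n}. c * y i) = ennreal (c powr d) * h y"
    and s: "s > 0"
  shows "(\<integral>\<^sup>+y. h y * indicator {..s} (sample_mean n y) \<partial>lborel_n n) =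
    ennreal (s powr (n + d)) * (\<integral>\<^sup>+y. h y * indicator {..1} (sample_mean n y) \<partial>lborel_n n)"
proof -
  have "(\<integral>\<^sup>+y. h y * indicator {..s} (sample_mean n y) \<partial>lborel_n n)
     = ennreal s ^ n * (\<integral>\<^sup>+y. h (\<lambda>i\<in>{1..n}. s * y i) *
          indicator {..s} (sample_mean n (\<lambda>i\<in>{1..n}. s * y i)) \<partial>lborel_n n)"
    using nn_integral_PiM_lborel_scale[OF s, of "{1..n}" "\<lambda>y. h y * indicator {..s} (sample_mean n y)"]
    by simp
  also have "(\<integral>\<^sup>+y. h (\<lambda>i\<in>{1..n}. s * y i) * indicator {..s} (sample_mean n (\<lambda>i\<in>{1..n}. s * y i)) \<partial>lborel_n n)
     = (\<integral>\<^sup>+y. ennreal (s powr d) * (h y * indicator {..1} (sample_mean n y)) \<partial>lborel_n n)"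
    using s by (intro nn_integral_cong)
      (auto simp: sample_mean_restrict_scale hom indicator_def mult.assoc)
  also have "\<dots> = ennreal (s powr d) * (\<integral>\<^sup>+y. h y * indicator {..1} (sample_mean n y) \<partial>lborel_n n)"
    by (intro nn_integral_cmult) measurable
  also have "ennreal s ^ n * (ennreal (s powr d) * (\<integral>\<^sup>+y. h y * indicator {..1} (sample_mean n y) \<partial>lborel_n n))
     = ennreal (s powr (n + d)) * (\<integral>\<^sup>+y. h y * indicator {..1} (sample_mean n y) \<partial>lborel_n n)"
    using s by (simp add: powr_add powr_realpow ennreal_mult' ennreal_power mult.assoc)
  finally show ?thesis .
qed

section \<open>Gamma samples\<close>

lemma sample_mean_pos:
  assumes "n > 0" "\<forall>i\<in>{1..n}. y i > 0"
  shows "sample_mean n y > 0"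
  using assms unfolding sample_mean_def by (intro mult_pos_pos sum_pos) auto

text \<open>
  The joint density splits as \<open>e (m) * w (y)\<close> with \<open>w\<close> homogeneous. Let \<open>V B\<close> be the law of the mean
  under \<open>w (y) dy\<close> restricted to \<open>R \<in> B\<close>. By scaling its distribution function at \<open>s > 0\<close> is
  \<open>s powr (n * a) * k B\<close>, so \<open>V B\<close> is proportional to \<open>V UNIV\<close>; integrating \<open>e\<close> over a Borel set
  preserves the proportion.
\<close>

lemma gamma_product_independent:
  fixes A :: "nat \<Rightarrow> nat \<Rightarrow> real" and a b :: real
  assumes n: "n > 0" and a: "a > 0" and b: "b > 0"
  defines "D \<equiv> density (lborel_n n) (\<lambda>y. \<Prod>i=1..n. ennreal (gamma_density a b (y i)))"
  assumes D: "prob_space D" and S: "S \<in> sets borel" and B: "B \<in> sets borel"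
  shows "emeasure D {y \<in> space D. sample_mean n y \<in> S \<and> root_Z_over_mean n A y \<in> B} =
    emeasure D {y \<in> space D. sample_mean n y \<in> S} * emeasure D {y \<in> space D. root_Z_over_mean n A y \<in> B}"
proof -
  let ?N = "lborel_n n" and ?m = "sample_mean n" and ?R = "root_Z_over_mean n A"
  define g where "g x = (if x > 0 then x powr (a - 1) else 0)" for x :: real
  define w where "w y = (\<Prod>i=1..n. g (y i))" for y
  define C where "C = 1 / (Gamma a * b powr a)"
  define e where "e t = ennreal (C ^ n * exp (- (n / b) * t))" for t
  have C: "C > 0" using a b by (simp add: C_def Gamma_real_pos)
  have e0: "e t > 0" "e t < \<top>" for t using C by (auto simp: e_def)
  have [measurable]: "g \<in> borel_measurable borel" unfolding g_def by measurable
  have w_meas [measurable]: "w \<in> borel_measurable ?N" unfolding w_def by measurable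
  have e_meas [measurable]: "e \<in> borel_measurable borel" unfolding e_def by measurable
  have w_nonneg: "w y \<ge> 0" for y unfolding w_def g_def by (intro prod_nonneg) auto
  have dens: "(\<Prod>i=1..n. ennreal (gamma_density a b (y i))) = e (?m y) * ennreal (w y)" for y
  proof -
    have "(\<Prod>i=1..n. ennreal (gamma_density a b (y i))) = (\<Prod>i=1..n. ennreal (C * g (y i) * exp (- y i / b)))"
      by (intro prod.cong refl) (auto simp: gamma_density_def C_def g_def)
    also have "\<dots> = ennreal (\<Prod>i=1..n. C * g (y i) * exp (- y i / b))"
      using C by (intro prod_ennreal) (auto simp: g_def)
    also have "(\<Prod>i=1..n. C * g (y i) * exp (- y i / b)) = C ^ n * w y * exp (\<Sum>i=1..n. - y i / b)"
      by (simp add: prod.distrib exp_sum w_def)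
    also have "(\<Sum>i=1..n. - y i / b) = - (n / b) * ?m y"
      using n by (simp add: sample_mean_def sum_negf flip: sum_divide_distrib)
    finally show ?thesis using C w_nonneg[of y]
      by (simp add: e_def ennreal_mult'[symmetric] mult_ac)
  qed
  define V where "V B' = distr (density ?N (\<lambda>y. ennreal (w y) * indicator B' (?R y))) borel ?m" for B'
  define k where "k B' = (\<integral>\<^sup>+y. ennreal (w y) * indicator B' (?R y) * indicator {..1} (?m y) \<partial>?N)" for B'
  have V_integral: "(\<integral>\<^sup>+t. h t \<partial>V B') = (\<integral>\<^sup>+y. ennreal (w y) * indicator B' (?R y) * h (?m y) \<partial>?N)"
    if [measurable]: "h \<in> borel_measurable borel" "B' \<in> sets borel" for h B'
    unfolding V_def by (subst nn_integral_distr, simp, simp, subst nn_integral_density) auto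
  have D_eq: "emeasure D {y \<in> space D. ?m y \<in> S' \<and> ?R y \<in> B'} = (\<integral>\<^sup>+t. e t * indicator S' t \<partial>V B')"
    if [measurable]: "S' \<in> sets borel" "B' \<in> sets borel" for S' B'
  proof -
    have "emeasure D {y \<in> space D. ?m y \<in> S' \<and> ?R y \<in> B'} =
      (\<integral>\<^sup>+y. (e (?m y) * ennreal (w y)) * indicator {y \<in> space ?N. ?m y \<in> S' \<and> ?R y \<in> B'} y \<partial>?N)"
      unfolding D_def dens by (subst emeasure_density) auto
    also have "\<dots> = (\<integral>\<^sup>+y. ennreal (w y) * indicator B' (?R y) * (e (?m y) * indicator S' (?m y)) \<partial>?N)"
      by (intro nn_integral_cong) (auto simp: indicator_def mult_ac)
    also have "\<dots> = (\<integral>\<^sup>+t. e t * indicator S' t \<partial>V B')" by (subst V_integral) auto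
    finally show ?thesis .
  qed
  have V_cdf: "emeasure (V B') {..s} = ennreal (if s > 0 then s powr (n * a) else 0) * k B'"
    if [measurable]: "B' \<in> sets borel" for B' s
  proof -
    have "emeasure (V B') {..s} = (\<integral>\<^sup>+y. ennreal (w y) * indicator B' (?R y) * indicator {..s} (?m y) \<partial>?N)"
      using V_integral[of "indicator {..s}" B'] by (simp add: V_def)
    also have "\<dots> = ennreal (if s > 0 then s powr (n * a) else 0) * k B'"
    proof (cases "s > 0")
      case True
      have hom: "ennreal (w (\<lambda>i\<in>{1..n}. c * y i)) * indicator B' (?R (\<lambda>i\<in>{1..n}. c * y i)) =
          ennreal (c powr (n * (a - 1))) * (ennreal (w y) * indicator B' (?R y))" if c: "c > 0" for c y
      proof -
        have "w (\<lambda>i\<in>{1..n}. c * y i) = (\<Prod>i=1..n. c powr (a - 1) * g (y i))"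
          unfolding w_def using c by (intro prod.cong refl) (auto simp: g_def powr_mult zero_less_mult_iff)
        also have "\<dots> = c powr (n * (a - 1)) * w y"
          using c by (simp add: prod.distrib w_def powr_powr powr_realpow[symmetric] mult.commute)
        finally show ?thesis using c
          by (simp add: root_Z_over_mean_restrict_scale ennreal_mult' mult.assoc)
      qed
      have "real n + n * (a - 1) = n * a" by (simp add: algebra_simps)
      with nn_integral_homogeneous_sample_mean_le[OF _ hom True] True show ?thesis
        by (simp add: k_def)
    next
      case False
      have "w y = 0" if le: "?m y \<le> s" for y
      proof -
        have "\<not> (\<forall>i\<in>{1..n}. y i > 0)" using sample_mean_pos[OF n, of y] le False by auto
        then obtain i where i: "i \<in> {1..n}" "\<not> y i > 0" by blast
        hence "g (y i) = 0" by (simp add: g_def)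
        with i show ?thesis unfolding w_def by (intro prod_zero) auto
      qed
      hence "(\<integral>\<^sup>+y. ennreal (w y) * indicator B' (?R y) * indicator {..s} (?m y) \<partial>?N) = (\<integral>\<^sup>+y. 0 \<partial>?N)"
        by (intro nn_integral_cong) (auto simp: indicator_def)
      thus ?thesis using False by simp
    qed
    finally show ?thesis .
  qed
  have total: "(\<integral>\<^sup>+t. e t \<partial>V UNIV) = 1"
    using D_eq[of UNIV UNIV] prob_space.emeasure_space_1[OF D] by simp
  \<comment> \<open>On \<open>{..1}\<close> the factor \<open>e\<close> is at least \<open>e 1\<close>, and the total mass is 1.\<close>
  have k_UNIV: "k UNIV \<noteq> \<top>"
  proof
    assume top: "k UNIV = \<top>"
    have "e 1 * k UNIV = (\<integral>\<^sup>+t. e 1 * indicator {..1} t \<partial>V UNIV)"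
      using V_cdf[of UNIV 1] by (subst nn_integral_cmult_indicator) (auto simp: V_def)
    also have "\<dots> \<le> (\<integral>\<^sup>+t. e t \<partial>V UNIV)"
    proof (intro nn_integral_mono)
      fix t
      have "e 1 \<le> e t" if "t \<le> 1"
      proof -
        have "n / b * t \<le> n / b * 1" using that b by (intro mult_left_mono) auto
        thus ?thesis unfolding e_def using C by (intro ennreal_leI mult_left_mono) auto
      qed
      thus "e 1 * indicator {..1} t \<le> e t" by (auto simp: indicator_def)
    qed
    finally show False using top e0[of 1] total by (auto simp: ennreal_mult_top top_unique split: if_splits)
  qed
  have k_pos: "k UNIV \<noteq> 0"
  proof
    assume "k UNIV = 0"
    hence "emeasure (V UNIV) (\<Union>i::nat. {..real i}) = 0"
      using V_cdf[of UNIV] by (intro emeasure_UN_eq_0) (auto simp: V_def)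
    also have "(\<Union>i::nat. {..real i}) = UNIV" by (auto intro: real_arch_simple)
    finally have "AE t in V UNIV. False"
      by (intro AE_I[of _ _ UNIV]) (auto simp: V_def)
    hence "(\<integral>\<^sup>+t. e t \<partial>V UNIV) = (\<integral>\<^sup>+t. 0 \<partial>V UNIV)" by (intro nn_integral_cong_AE) auto
    with total show False by simp
  qed
  have k_le: "k B' \<le> k UNIV" for B'
    unfolding k_def by (intro nn_integral_mono) (auto simp: indicator_def)
  \<comment> \<open>Cross-multiplied form of proportionality, which avoids dividing in the extended reals.\<close>
  have V_prop: "density (V B') (\<lambda>_. k UNIV) = density (V UNIV) (\<lambda>_. k B')"
    if [measurable]: "B' \<in> sets borel" for B'
  proof (rule measure_eqI_generator_eq[where E = "range (\<lambda>s::real. {..s})" and \<Omega> = UNIV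
        and A = "\<lambda>i::nat. {..real i}"])
    show "Int_stable (range (\<lambda>s::real. {..s}))" by (auto simp: Int_stable_def)
    have sets_V: "sets (V B'') = sets borel" for B'' by (simp add: V_def)
    have dens_cdf: "emeasure (density (V B'') (\<lambda>_. c)) {..s} = c * emeasure (V B'') {..s}" for B'' c s
      by (subst emeasure_density) (auto simp: sets_V nn_integral_cmult_indicator)
    show "emeasure (density (V B') (\<lambda>_. k UNIV)) X = emeasure (density (V UNIV) (\<lambda>_. k B')) X"
      if "X \<in> range (\<lambda>s::real. {..s})" for X
      using that by (auto simp: dens_cdf V_cdf mult_ac)
    show "emeasure (density (V B') (\<lambda>_. k UNIV)) {..real i} \<noteq> \<infinity>" for i :: nat
      using k_UNIV k_le[of B'] by (auto simp: dens_cdf V_cdf ennreal_mult_eq_top_iff top_unique)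
    show "sets (density (V B') (\<lambda>_. k UNIV)) = sigma_sets UNIV (range (\<lambda>s::real. {..s}))"
      "sets (density (V UNIV) (\<lambda>_. k B')) = sigma_sets UNIV (range (\<lambda>s::real. {..s}))"
      by (simp_all add: sets_V borel_eq_atMost)
    show "(\<Union>i::nat. {..real i}) = UNIV" by (auto intro: real_arch_simple)
  qed auto
  have factor: "k UNIV * emeasure D {y \<in> space D. ?m y \<in> S' \<and> ?R y \<in> B'} =
      k B' * emeasure D {y \<in> space D. ?m y \<in> S'}"
    if [measurable]: "S' \<in> sets borel" "B' \<in> sets borel" for S' B'
  proof -
    have int: "(\<integral>\<^sup>+t. e t * indicator S' t \<partial>density (V B'') (\<lambda>_. c)) = c * (\<integral>\<^sup>+t. e t * indicator S' t \<partial>V B'')" for c B''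
      by (subst nn_integral_density) (auto simp: V_def nn_integral_cmult)
    have "k UNIV * (\<integral>\<^sup>+t. e t * indicator S' t \<partial>V B') = k B' * (\<integral>\<^sup>+t. e t * indicator S' t \<partial>V UNIV)"
      using V_prop[of B'] by (simp flip: int)
    with D_eq[of S' B'] D_eq[of S' UNIV] show ?thesis by simp
  qed
  have kB: "k UNIV * emeasure D {y \<in> space D. ?R y \<in> B} = k B"
    using factor[OF _ B, of UNIV] prob_space.emeasure_space_1[OF D] by simp
  have "k UNIV * emeasure D {y \<in> space D. ?m y \<in> S \<and> ?R y \<in> B} =
      k UNIV * (emeasure D {y \<in> space D. ?m y \<in> S} * emeasure D {y \<in> space D. ?R y \<in> B})"
    unfolding factor[OF S B] kB[symmetric] by (simp only: mult_ac)
  thus ?thesis using k_pos k_UNIV by (simp add: ennreal_mult_cancel_left)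
qed

section \<open>The shape integral\<close>

text \<open>
  This is where positive definiteness enters: a small value of \<open>sqrt Z / m\<close> forces all relative
  deviations from the mean to be small.
\<close>

lemma root_Z_over_mean_controls_deviation:
  assumes A: "positive_definite n A" and n: "n > 0"
  shows "\<exists>K>0. \<forall>y e. sample_mean n y > 0 \<longrightarrow> root_Z_over_mean n A y \<le> e \<longrightarrow>
    (\<forall>i\<in>{1..n}. \<bar>y i / sample_mean n y - 1\<bar> \<le> K * e)"
proof -
  obtain l where l: "l > 0" "\<And>y i. i \<in> {1..n} \<Longrightarrow> l * (y i - sample_mean n y)\<^sup>2 \<le> Z_statistic n A y"
    using Z_statistic_coercive[OF A n] by blast
  have "\<bar>y i / sample_mean n y - 1\<bar> \<le> 1 / sqrt l * e"
    if m: "sample_mean n y > 0" and R: "root_Z_over_mean n A y \<le> e" and i: "i \<in> {1..n}" for y e i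
  proof -
    have "sqrt l * \<bar>y i - sample_mean n y\<bar> = sqrt (l * (y i - sample_mean n y)\<^sup>2)"
      by (simp add: real_sqrt_mult)
    also have "\<dots> \<le> sqrt (Z_statistic n A y)" using l(2)[OF i] by simp
    also have "\<dots> \<le> e * sample_mean n y"
      using R m by (simp add: root_Z_over_mean_def field_simps)
    finally have "\<bar>y i - sample_mean n y\<bar> / sample_mean n y \<le> 1 / sqrt l * e"
      using l(1) m by (simp add: field_simps)
    moreover have "\<bar>y i / sample_mean n y - 1\<bar> = \<bar>y i - sample_mean n y\<bar> / sample_mean n y"
      using m by (simp add: field_simps abs_divide)
    ultimately show ?thesis by simp
  qed
  with l(1) show ?thesis by (intro exI[of _ "1 / sqrt l"]) auto
qed

lemma sum_div_sample_mean:
  assumes "n > 0" "sample_mean n y \<noteq> 0"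
  shows "(\<Sum>i=1..n. y i / sample_mean n y) = n"
proof -
  have "(\<Sum>i=1..n. y i) = n * sample_mean n y" using assms(1) by (simp add: sample_mean_def)
  thus ?thesis using assms by (simp flip: sum_divide_distrib)
qed

text \<open>
  The inequality of arithmetic and geometric means for \<open>y i / m\<close>, whose arithmetic mean is 1, with
  its equality case; again from \<open>ln u \<le> u - 1\<close>.
\<close>

lemma prod_div_sample_mean_le_1:
  assumes n: "n > 0" and y: "\<forall>i\<in>{1..n}. y i > 0"
  shows "(\<Prod>i=1..n. y i / sample_mean n y) \<le> 1"
    and "j \<in> {1..n} \<Longrightarrow> y j \<noteq> sample_mean n y \<Longrightarrow> (\<Prod>i=1..n. y i / sample_mean n y) < 1"
proof -
  let ?u = "\<lambda>i. y i / sample_mean n y"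
  have m: "sample_mean n y > 0" by (rule sample_mean_pos[OF n y])
  have u: "?u i > 0" if "i \<in> {1..n}" for i using y m that by simp
  have eq: "(\<Prod>i=1..n. ?u i) = exp (\<Sum>i=1..n. ln (?u i))"
    using u by (simp add: exp_sum)
  have zero: "(\<Sum>i=1..n. ?u i - 1) = 0"
    using sum_div_sample_mean[OF n, of y] m by (simp add: sum_subtractf)
  have le: "ln (?u i) \<le> ?u i - 1" if "i \<in> {1..n}" for i using u[OF that] by (rule ln_le_minus_one)
  show "(\<Prod>i=1..n. ?u i) \<le> 1"
    using sum_mono[of "{1..n}" "\<lambda>i. ln (?u i)" "\<lambda>i. ?u i - 1"] le zero by (simp add: eq)
  show "(\<Prod>i=1..n. ?u i) < 1" if j: "j \<in> {1..n}" "y j \<noteq> sample_mean n y"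
  proof -
    have "ln (?u j) \<noteq> ?u j - 1" using ln_eq_minus_one[OF u[OF j(1)]] j(2) m by auto
    with le[OF j(1)] have "\<exists>i\<in>{1..n}. ln (?u i) < ?u i - 1" using j(1) by (intro bexI[of _ j]) auto
    hence "(\<Sum>i=1..n. ln (?u i)) < (\<Sum>i=1..n. ?u i - 1)"
      using le by (intro sum_strict_mono_ex1) auto
    with zero show ?thesis by (simp add: eq)
  qed
qed

text \<open>
  The density \<open>x powr a\<close> evaluated at the shape \<open>y / m\<close>. Positivity is tested on \<open>y i\<close> itself, since
  \<open>y i / m\<close> is also positive when both are negative.
\<close>

definition shape_weight :: "nat \<Rightarrow> real \<Rightarrow> (nat \<Rightarrow> real) \<Rightarrow> real" where
  "shape_weight n a y = (\<Prod>i=1..n. if y i > 0 then (y i / sample_mean n y) powr a else 0)"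

lemma shape_weight_nonneg: "shape_weight n a y \<ge> 0"
  unfolding shape_weight_def by (intro prod_nonneg) auto

lemma measurable_shape_weight [measurable]:
  "shape_weight n a \<in> borel_measurable (\<Pi>\<^sub>M i\<in>{1..n}. borel)"
  unfolding shape_weight_def by measurable

lemma shape_weight_eq_powr:
  assumes n: "n > 0" and y: "\<forall>i\<in>{1..n}. y i > 0"
  shows "shape_weight n a y = (\<Prod>i=1..n. y i / sample_mean n y) powr a"
  using y sample_mean_pos[OF n y] unfolding shape_weight_def
  by (subst prod_powr_distrib) (auto intro!: prod.cong simp: less_imp_le)

lemma shape_weight_eq_0: "i \<in> {1..n} \<Longrightarrow> y i \<le> 0 \<Longrightarrow> shape_weight n a y = 0"
  unfolding shape_weight_def by (intro prod_zero bexI[of _ i]) auto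

lemma shape_weight_antimono:
  assumes n: "n > 0" and ab: "a \<le> b"
  shows "shape_weight n b y \<le> shape_weight n a y"
proof (cases "\<forall>i\<in>{1..n}. y i > 0")
  case y: True
  have m: "sample_mean n y > 0" by (rule sample_mean_pos[OF n y])
  have "(\<Prod>i=1..n. y i / sample_mean n y) > 0" using y m by (intro prod_pos) auto
  thus ?thesis
    using prod_div_sample_mean_le_1(1)[OF n y] ab
    by (simp add: shape_weight_eq_powr[OF n y] powr_mono')
next
  case False
  then obtain i where "i \<in> {1..n}" "y i \<le> 0" by force
  thus ?thesis by (simp add: shape_weight_eq_0)
qed

text \<open>
  A truncated cone is used instead of the slice \<open>m = 1\<close>, which avoids surface measures;
  because the integrand is homogeneous of degree 0, both carry the same information.
\<close>

definition shape_integral :: "nat \<Rightarrow> (nat \<Rightarrow> nat \<Rightarrow> real) \<Rightarrow> real \<Rightarrow> real \<Rightarrow> ennreal" where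
  "shape_integral n A a e = (\<integral>\<^sup>+y. ennreal (shape_weight n a y) * indicator {..e} (root_Z_over_mean n A y)
     * indicator {..1} (sample_mean n y) \<partial>lborel_n n)"

text \<open>
  The assumption keeps the shape in \<open>[1/2, 3/2]\<close>, so the weight is bounded and the domain of integration
  lies in a cube.
\<close>

lemma shape_integral_finite:
  assumes n: "n > 0"
    and near: "\<And>y i. sample_mean n y > 0 \<Longrightarrow> root_Z_over_mean n A y \<le> e \<Longrightarrow> i \<in> {1..n} \<Longrightarrow>
       \<bar>y i / sample_mean n y - 1\<bar> \<le> 1 / 2"
  shows "shape_integral n A a e < \<top>"
proof -
  interpret product_sigma_finite "\<lambda>_::nat. lborel :: real measure" by standard
  define Q :: "(nat \<Rightarrow> real) set" where "Q = (\<Pi>\<^sub>E i\<in>{1..n}. {0..2})"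
  have Q: "Q \<in> sets (lborel_n n)" unfolding Q_def by (intro sets_PiM_I_finite) auto
  have "shape_integral n A a e \<le> (\<integral>\<^sup>+y. ennreal ((2 powr \<bar>a\<bar>) ^ n) * indicator Q y \<partial>lborel_n n)"
    unfolding shape_integral_def
  proof (intro nn_integral_mono)
    fix y assume sp: "y \<in> space (lborel_n n)"
    show "ennreal (shape_weight n a y) * indicator {..e} (root_Z_over_mean n A y) * indicator {..1} (sample_mean n y)
        \<le> ennreal ((2 powr \<bar>a\<bar>) ^ n) * indicator Q y"
    proof (cases "(\<forall>i\<in>{1..n}. y i > 0) \<and> root_Z_over_mean n A y \<le> e \<and> sample_mean n y \<le> 1")
      case True
      hence m: "sample_mean n y > 0" "sample_mean n y \<le> 1" using sample_mean_pos[OF n, of y] by auto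
      have u: "1 / 2 \<le> y i / sample_mean n y" "y i / sample_mean n y \<le> 3 / 2" if "i \<in> {1..n}" for i
      proof -
        have "\<bar>y i / sample_mean n y - 1\<bar> \<le> 1 / 2" using near[OF m(1) _ that] True by blast
        thus "1 / 2 \<le> y i / sample_mean n y" "y i / sample_mean n y \<le> 3 / 2" by linarith+
      qed
      have "shape_weight n a y \<le> (\<Prod>i=1..n. 2 powr \<bar>a\<bar>)"
        unfolding shape_weight_def
      proof (intro prod_mono conjI)
        fix i assume i: "i \<in> {1..n}"
        let ?u = "y i / sample_mean n y"
        have "0 \<le> ?u" "?u \<le> 2" using u[OF i] by linarith+
        have "?u powr a \<le> 2 powr \<bar>a\<bar>"
        proof (cases "a \<ge> 0")
          case True thus ?thesis using \<open>0 \<le> ?u\<close> \<open>?u \<le> 2\<close> by (simp add: powr_mono2)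
        next
          case False
          hence "?u powr a \<le> (1 / 2) powr a" using u[OF i] by (intro powr_mono2') auto
          also have "\<dots> = 2 powr \<bar>a\<bar>" using False by (simp add: powr_divide powr_minus_divide)
          finally show ?thesis .
        qed
        thus "(if y i > 0 then ?u powr a else 0) \<le> 2 powr \<bar>a\<bar>" by simp
      qed auto
      moreover have "y \<in> Q"
      proof -
        have "0 \<le> y i \<and> y i \<le> 2" if "i \<in> {1..n}" for i
        proof -
          have "y i \<le> 3 / 2 * sample_mean n y" using u(2)[OF that] m by (simp add: field_simps)
          thus ?thesis using True that m by (auto simp: less_imp_le)
        qed
        thus ?thesis using sp unfolding Q_def by (auto simp: space_PiM PiE_iff)
      qed
      ultimately show ?thesis using True by (auto simp: indicator_def intro: ennreal_leI)
    next
      case False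
      then consider i where "i \<in> {1..n}" "y i \<le> 0" | "\<not> root_Z_over_mean n A y \<le> e" | "\<not> sample_mean n y \<le> 1"
        by fastforce
      thus ?thesis by cases (auto simp: shape_weight_eq_0)
    qed
  qed
  also have "\<dots> = ennreal ((2 powr \<bar>a\<bar>) ^ n) * emeasure (lborel_n n) Q"
    using Q by (rule nn_integral_cmult_indicator)
  also have "emeasure (lborel_n n) Q = ennreal 2 ^ n"
    unfolding Q_def by (subst emeasure_PiM) auto
  also have "ennreal ((2 powr \<bar>a\<bar>) ^ n) * ennreal 2 ^ n < \<top>"
    by (simp add: ennreal_mult_less_top power_less_top_ennreal)
  finally show ?thesis .
qed

text \<open>
  The weights are powers of \<open>\<Prod>i. y i / m \<le> 1\<close>, hence ordered. For strictness it suffices to have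
  nonconstant samples, for which the product is below 1, on a set of positive measure: the box
  \<open>Q\<close> around \<open>(1/2, ..., 1/2)\<close> separates the first coordinate from the others.
\<close>

lemma shape_integral_strict_antimono:
  assumes n: "n \<ge> 2" and e: "e > 0" and ab: "a < b" and fin: "shape_integral n A b e < \<top>"
  shows "shape_integral n A b e < shape_integral n A a e"
proof -
  interpret product_sigma_finite "\<lambda>_::nat. lborel :: real measure" by standard
  define C where "C = (\<Sum>i=1..n. \<Sum>j=1..n. \<bar>A i j\<bar>)"
  have C: "C \<ge> 0" unfolding C_def by (intro sum_nonneg) auto
  \<comment> \<open>In a box of half-width \<open>h \<le> 1/4\<close> around \<open>1/2\<close> deviations from the mean are at most \<open>2 h\<close> and the mean
    is at least \<open>1/4\<close>, so that \<open>sqrt Z / m\<close> is at most \<open>8 h sqrt C\<close>. Adding 1 guards against \<open>C = 0\<close>.\<close>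
  define h where "h = min (1 / 4) (e / (8 * sqrt C + 1))"
  have h: "0 < h" "h \<le> 1 / 4" "8 * sqrt C * h \<le> e"
  proof -
    show "0 < h" using e C by (auto simp: h_def intro!: divide_pos_pos add_nonneg_pos)
    have "8 * sqrt C * h \<le> (8 * sqrt C + 1) * (e / (8 * sqrt C + 1))"
      using C e by (intro mult_mono) (auto simp: h_def)
    also have "\<dots> = e" using C by (smt (verit) nonzero_mult_div_cancel_left real_sqrt_ge_zero times_divide_eq_right)
    finally show "8 * sqrt C * h \<le> e" .
    show "h \<le> 1 / 4" unfolding h_def by (rule min.cobounded1)
  qed
  define Q :: "(nat \<Rightarrow> real) set" where
    "Q = (\<Pi>\<^sub>E i\<in>{1..n}. if i = 1 then {1/2<..<1/2 + h} else {1/2 - h<..<1/2})"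
  have Q: "Q \<in> sets (lborel_n n)" unfolding Q_def by (intro sets_PiM_I_finite) auto
  have "emeasure (lborel_n n) Q =
      (\<Prod>i=1..n. emeasure lborel (if i = 1 then {1/2<..<1/2 + h} else {1/2 - h<..<1/2}))"
    unfolding Q_def by (subst emeasure_PiM) auto
  also have "\<dots> = (\<Prod>i=1..n. ennreal h)" using h by (intro prod.cong) auto
  finally have Q_pos: "emeasure (lborel_n n) Q > 0" using h by (simp add: ennreal_power)
  let ?F = "\<lambda>a y. ennreal (shape_weight n a y) * indicator {..e} (root_Z_over_mean n A y)
     * indicator {..1} (sample_mean n y)"
  have less: "?F b y < ?F a y" if y: "y \<in> Q" for y
  proof -
    have near: "\<bar>y i - 1 / 2\<bar> \<le> h" if "i \<in> {1..n}" for i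
      using y that by (auto simp: Q_def PiE_iff Ball_def abs_le_iff split: if_splits)
    have "y i > 0" if "i \<in> {1..n}" for i using near[OF that] h by (auto simp: abs_le_iff)
    hence ypos: "\<forall>i\<in>{1..n}. y i > 0" by blast
    have "(\<Sum>i=1..n. y i - 1 / 2) = (\<Sum>i=1..n. y i) - n / 2" by (simp add: sum_subtractf)
    moreover have "sample_mean n y - 1 / 2 = (1 / n) * ((\<Sum>i=1..n. y i) - n / 2)"
      using n by (simp add: sample_mean_def field_simps)
    ultimately have "sample_mean n y - 1 / 2 = (1 / n) * (\<Sum>i=1..n. y i - 1 / 2)" by simp
    hence "\<bar>sample_mean n y - 1 / 2\<bar> = (1 / n) * \<bar>\<Sum>i=1..n. y i - 1 / 2\<bar>"
      by (simp add: abs_mult)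
    also have "\<bar>\<Sum>i=1..n. y i - 1 / 2\<bar> \<le> (\<Sum>i=1..n. h)"
      using near by (intro order_trans[OF sum_abs] sum_mono) auto
    finally have m: "\<bar>sample_mean n y - 1 / 2\<bar> \<le> h" using n by (simp add: divide_right_mono)
    have "Z_statistic n A y \<le> C * (2 * h)\<^sup>2"
      unfolding C_def using near m by (intro Z_statistic_bounded) (fastforce simp: abs_le_iff)
    hence "sqrt (Z_statistic n A y) \<le> sqrt C * (2 * h)"
      using h by (metis abs_of_nonneg less_imp_le mult_nonneg_nonneg real_sqrt_abs real_sqrt_le_mono real_sqrt_mult zero_le_numeral)
    also have "\<dots> \<le> e / 4" using h by simp
    also have "\<dots> \<le> e * sample_mean n y" using m h e by (auto simp: abs_le_iff)
    finally have R: "root_Z_over_mean n A y \<le> e"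
      using m h by (simp add: root_Z_over_mean_def field_simps abs_le_iff)
    have yQ: "y i \<in> (if i = 1 then {1/2<..<1/2 + h} else {1/2 - h<..<1/2})" if "i \<in> {1..n}" for i
      using y that unfolding Q_def by (rule PiE_mem)
    have "y 1 > 1 / 2" "y 2 < 1 / 2" using yQ[of 1] yQ[of 2] n by auto
    then obtain j where j: "j \<in> {1..n}" "y j \<noteq> sample_mean n y" using n
      by (metis atLeastAtMost_iff less_asym' one_le_numeral order.refl order_trans)
    let ?p = "\<Prod>i=1..n. y i / sample_mean n y"
    have n0: "n > 0" using n by simp
    have "?p < 1" using prod_div_sample_mean_le_1(2)[OF n0 ypos j] by blast
    moreover have "?p > 0" using ypos sample_mean_pos[OF n0 ypos] by (intro prod_pos) auto
    ultimately have "shape_weight n b y < shape_weight n a y"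
      using ab by (simp add: shape_weight_eq_powr[OF n0 ypos] powr_less_mono')
    thus ?thesis using R m h shape_weight_nonneg[of n b y]
      by (auto simp: abs_le_iff ennreal_less_iff)
  qed
  show ?thesis unfolding shape_integral_def
  proof (rule nn_integral_less)
    show "AE y in lborel_n n. ?F b y \<le> ?F a y"
      using shape_weight_antimono[of n a b] n ab
      by (intro AE_I2 mult_right_mono ennreal_leI) auto
    show "\<not> (AE y in lborel_n n. ?F a y \<le> ?F b y)"
    proof
      assume "AE y in lborel_n n. ?F a y \<le> ?F b y"
      hence "AE y in lborel_n n. y \<notin> Q" using less by (auto elim!: eventually_mono simp: not_le[symmetric])
      hence "Q \<in> null_sets (lborel_n n)" by (simp only: AE_iff_null_sets[OF Q])
      hence "emeasure (lborel_n n) Q = 0" by (rule null_setsD1)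
      with Q_pos show False by simp
    qed
  qed (use fin in \<open>auto simp: shape_integral_def\<close>)
qed

text \<open>
  Scaling turns the cone \<open>m \<le> 1\<close> into \<open>m \<le> 1 + d\<close> with factor \<open>(1 + d) ^ n\<close>; the shell is the difference.
\<close>

lemma shape_integral_shell:
  assumes n: "n > 0" and d: "d > 0" and fin: "shape_integral n A a e < \<top>"
  shows "(\<integral>\<^sup>+y. ennreal (shape_weight n a y) * indicator {..e} (root_Z_over_mean n A y)
     * indicator {1<..1 + d} (sample_mean n y) \<partial>lborel_n n) = ennreal ((1 + d) ^ n - 1) * shape_integral n A a e"
proof -
  let ?h = "\<lambda>y. ennreal (shape_weight n a y) * indicator {..e} (root_Z_over_mean n A y)"
  let ?I = "\<lambda>S. \<integral>\<^sup>+y. ?h y * indicator S (sample_mean n y) \<partial>lborel_n n"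
  have hom: "?h (\<lambda>i\<in>{1..n}. c * y i) = ennreal (c powr 0) * ?h y" if "c > 0" for c y
  proof -
    have "shape_weight n a (\<lambda>i\<in>{1..n}. c * y i) = shape_weight n a y"
      unfolding shape_weight_def sample_mean_restrict_scale using that
      by (intro prod.cong refl) (auto simp: zero_less_mult_iff)
    thus ?thesis using that by (simp add: root_Z_over_mean_restrict_scale)
  qed
  have "?I {..1 + d} = ennreal ((1 + d) powr (real n + 0)) * ?I {..1}"
    using d by (intro nn_integral_homogeneous_sample_mean_le hom) auto
  hence "?I {..1 + d} = ennreal ((1 + d) ^ n) * ?I {..1}" using d by (simp add: powr_realpow)
  also have "ennreal ((1 + d) ^ n) = ennreal (((1 + d) ^ n - 1) + 1)" by simp
  also have "\<dots> = ennreal ((1 + d) ^ n - 1) + 1" using d by (subst ennreal_plus) auto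
  finally have "?I {..1 + d} = ennreal ((1 + d) ^ n - 1) * ?I {..1} + ?I {..1}"
    by (simp only: distrib_right mult_1_left)
  moreover have "?I {..1 + d} = ?I {..1} + ?I {1<..1 + d}"
    using d by (subst nn_integral_add[symmetric]) (auto intro!: nn_integral_cong simp: indicator_def)
  ultimately have "?I {..1} + ?I {1<..1 + d} = ?I {..1} + ennreal ((1 + d) ^ n - 1) * ?I {..1}"
    by (simp only: add.commute)
  thus ?thesis using fin by (auto simp: shape_integral_def ennreal_add_left_cancel)
qed

section \<open>Samples with a prescribed mean and small dispersion\<close>

definition sample_law :: "nat \<Rightarrow> (real \<Rightarrow> real) \<Rightarrow> (nat \<Rightarrow> real) measure" where
  "sample_law n g = density (lborel_n n) (\<lambda>y. \<Prod>i=1..n. ennreal (g (y i)))"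

text \<open>
  The interval is taken relative to \<open>x\<close> so that rescaling the sample by \<open>x\<close> moves it to \<open>(1, 1 + d]\<close>
  for every \<open>x\<close>.
\<close>

definition shell_prob :: "nat \<Rightarrow> (nat \<Rightarrow> nat \<Rightarrow> real) \<Rightarrow> (real \<Rightarrow> real) \<Rightarrow> real \<Rightarrow> real \<Rightarrow> real \<Rightarrow> ennreal" where
  "shell_prob n A g x d e = emeasure (sample_law n g)
     {y \<in> space (sample_law n g). sample_mean n y \<in> {x<..x * (1 + d)} \<and> root_Z_over_mean n A y \<in> {..e}}"

lemma shell_prob_rescaled:
  assumes [measurable]: "g \<in> borel_measurable borel" and x: "x > 0"
  shows "shell_prob n A g x d e = ennreal (x ^ n) *
    (\<integral>\<^sup>+y. (\<Prod>i=1..n. ennreal (g (x * y i))) * indicator {..e} (root_Z_over_mean n A y)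
       * indicator {1<..1 + d} (sample_mean n y) \<partial>lborel_n n)"
proof -
  let ?h = "\<lambda>y. (\<Prod>i=1..n. ennreal (g (y i))) * indicator {..e} (root_Z_over_mean n A y)
       * indicator {x<..x * (1 + d)} (sample_mean n y)"
  have "shell_prob n A g x d e = (\<integral>\<^sup>+y. ?h y \<partial>lborel_n n)"
    unfolding shell_prob_def sample_law_def
    by (subst emeasure_density) (auto intro!: nn_integral_cong simp: indicator_def)
  also have "\<dots> = ennreal x ^ card {1..n} * (\<integral>\<^sup>+y. ?h (\<lambda>i\<in>{1..n}. x * y i) \<partial>lborel_n n)"
    by (rule nn_integral_PiM_lborel_scale[OF x]) auto
  also have "(\<integral>\<^sup>+y. ?h (\<lambda>i\<in>{1..n}. x * y i) \<partial>lborel_n n) =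
    (\<integral>\<^sup>+y. (\<Prod>i=1..n. ennreal (g (x * y i))) * indicator {..e} (root_Z_over_mean n A y)
       * indicator {1<..1 + d} (sample_mean n y) \<partial>lborel_n n)"
    using x by (intro nn_integral_cong)
      (auto simp: sample_mean_restrict_scale root_Z_over_mean_restrict_scale indicator_def)
  finally show ?thesis using x by (simp add: ennreal_power)
qed

lemma eventually_exp_powr_near_1:
  fixes p q eta :: real
  assumes "eta > 0"
  shows "\<forall>\<^sub>F d in at_right 0. \<forall>s. 1 < s \<longrightarrow> s \<le> 1 + d \<longrightarrow> \<bar>exp (p * (s - 1)) * s powr q - 1\<bar> \<le> eta"
proof -
  have "((\<lambda>s. exp (p * (s - 1)) * s powr q) \<longlongrightarrow> exp (p * (1 - 1)) * 1 powr q) (at_right 1)"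
    by (intro tendsto_intros) auto
  hence "\<forall>\<^sub>F s in at_right 1. dist (exp (p * (s - 1)) * s powr q) 1 < eta"
    using assms by (auto dest: tendstoD)
  then obtain b where b: "b > 1" "\<And>s. 1 < s \<Longrightarrow> s < b \<Longrightarrow> dist (exp (p * (s - 1)) * s powr q) 1 < eta"
    unfolding eventually_at_right_field by blast
  have "\<forall>\<^sub>F d in at_right 0. d \<in> {0<..<b - 1}" using b(1) by (intro eventually_at_right_real) simp
  thus ?thesis
  proof eventually_elim
    case (elim d)
    thus ?case using b(2) by (auto simp: dist_real_def less_imp_le)
  qed
qed

text \<open>
  The linear term of a touching curve depends on the sample only through its mean, and the
  logarithmic term splits into a function of the mean and the shape weight.
\<close>

lemma prod_exp_powr_eq:
  assumes n: "n > 0" and y: "\<forall>i\<in>{1..n}. y i > 0"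
  shows "(\<Prod>i=1..n. c * exp (b * (y i - 1)) * y i powr a) =
    c ^ n * (exp (n * b * (sample_mean n y - 1)) * sample_mean n y powr (n * a)) * shape_weight n a y"
proof -
  let ?m = "sample_mean n y"
  have m: "?m > 0" by (rule sample_mean_pos[OF n y])
  have "(\<Prod>i=1..n. c * exp (b * (y i - 1)) * y i powr a) =
      c ^ n * exp (\<Sum>i=1..n. b * (y i - 1)) * (\<Prod>i=1..n. y i powr a)"
    by (simp add: prod.distrib exp_sum)
  also have "(\<Sum>i=1..n. b * (y i - 1)) = n * b * (?m - 1)"
    using n by (simp add: sample_mean_def sum_subtractf flip: sum_distrib_left) (simp add: algebra_simps)
  also have "(\<Prod>i=1..n. y i powr a) = (\<Prod>i=1..n. ?m powr a * (if y i > 0 then (y i / ?m) powr a else 0))"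
    using y m by (intro prod.cong refl) (auto simp: powr_mult[symmetric] less_imp_le)
  also have "\<dots> = ?m powr (n * a) * shape_weight n a y"
    using m by (simp add: prod.distrib shape_weight_def powr_powr powr_realpow[symmetric] mult.commute)
  finally show ?thesis by (simp add: mult_ac)
qed

text \<open>
  The point is \<open>(1 + r / 3)\<^sup>2 \<le> 1 + r\<close> for \<open>r \<le> 1\<close>.
\<close>

lemma near_1_if_small_deviation:
  fixes u s r :: real
  assumes "\<bar>u - 1\<bar> \<le> r / 3" "1 < s" "s \<le> 1 + r / 3" "r \<le> 1"
  shows "\<bar>u * s - 1\<bar> \<le> r"
proof -
  have u: "u \<ge> 0" "u \<le> 1 + r / 3" "1 - r / 3 \<le> u" using assms by linarith+
  have "u * s \<le> (1 + r / 3) * (1 + r / 3)" using assms u by (intro mult_mono) auto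
  also have "\<dots> = 1 + 2 * r / 3 + r / 9 * r" by (simp add: algebra_simps)
  also have "r / 9 * r \<le> r / 9 * 1" using assms by (intro mult_left_mono) auto
  finally have "u * s \<le> 1 + r" using assms by linarith
  moreover have "(1 - r / 3) * 1 \<le> u * s" using assms u by (intro mult_mono) auto
  ultimately show ?thesis using assms by (auto simp: abs_le_iff)
qed

text \<open>
  On the shell all \<open>x * y i\<close> lie in the neighbourhood of \<open>x\<close> where the one-sided bound on \<open>g\<close> is
  available. Multiplying the bounds gives a function of the mean, which is within \<open>eta\<close> of a constant
  on a thin shell, times the shape weight.
\<close>

lemma shell_prob_bounds:
  assumes n: "n > 0" and g: "g \<in> borel_measurable borel" "\<And>x. g x \<ge> 0" "\<And>x. x \<le> 0 \<Longrightarrow> g x = 0"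
    and x: "x > 0" and r: "r \<le> 1 / 2" and c: "c \<ge> 0" and eta: "0 < eta" "eta < 1"
    and near: "\<And>y i. sample_mean n y > 0 \<Longrightarrow> root_Z_over_mean n A y \<le> e \<Longrightarrow> i \<in> {1..n} \<Longrightarrow>
       \<bar>y i / sample_mean n y - 1\<bar> \<le> r / 3"
    and r0: "r > 0" and fin: "shape_integral n A a e < \<top>"
  shows "(\<And>t. \<bar>t - 1\<bar> \<le> r \<Longrightarrow> g (x * t) \<le> c * exp (b * (t - 1)) * t powr a) \<Longrightarrow>
      \<forall>\<^sub>F d in at_right 0. shell_prob n A g x d e \<le>
        ennreal (x ^ n * c ^ n * (1 + eta) * ((1 + d) ^ n - 1)) * shape_integral n A a e"
    and "(\<And>t. \<bar>t - 1\<bar> \<le> r \<Longrightarrow> g (x * t) \<ge> c * exp (b * (t - 1)) * t powr a) \<Longrightarrow>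
      \<forall>\<^sub>F d in at_right 0. shell_prob n A g x d e \<ge>
        ennreal (x ^ n * c ^ n * (1 - eta) * ((1 + d) ^ n - 1)) * shape_integral n A a e"
proof -
  let ?R = "root_Z_over_mean n A" and ?m = "sample_mean n"
  let ?E = "\<lambda>s. exp (n * b * (s - 1)) * s powr (n * a)"
  have ev: "\<forall>\<^sub>F d in at_right 0. d \<in> {0<..<r / 3} \<and> (\<forall>s. 1 < s \<longrightarrow> s \<le> 1 + d \<longrightarrow> \<bar>?E s - 1\<bar> \<le> eta)"
    using r0 by (intro eventually_conj eventually_exp_powr_near_1 eta eventually_at_right_real) simp
  have y_near: "\<bar>y i - 1\<bar> \<le> r" if "1 < ?m y" "?m y \<le> 1 + d" "d < r / 3" "?R y \<le> e" "i \<in> {1..n}" for y d i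
  proof -
    have "\<bar>y i / ?m y - 1\<bar> \<le> r / 3" using that by (intro near) auto
    hence "\<bar>y i / ?m y * ?m y - 1\<bar> \<le> r" using that r by (intro near_1_if_small_deviation) auto
    thus ?thesis using that by simp
  qed
  have shell: "(\<integral>\<^sup>+y. ennreal (k * shape_weight n a y) * indicator {..e} (?R y) * indicator {1<..1 + d} (?m y) \<partial>lborel_n n)
      = ennreal (k * ((1 + d) ^ n - 1)) * shape_integral n A a e" if "k \<ge> 0" "d > 0" for k d
  proof -
    have "(\<integral>\<^sup>+y. ennreal (k * shape_weight n a y) * indicator {..e} (?R y) * indicator {1<..1 + d} (?m y) \<partial>lborel_n n)
       = (\<integral>\<^sup>+y. ennreal k * (ennreal (shape_weight n a y) * indicator {..e} (?R y) * indicator {1<..1 + d} (?m y)) \<partial>lborel_n n)"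
      using that by (intro nn_integral_cong) (simp add: ennreal_mult' mult.assoc)
    also have "\<dots> = ennreal k * (ennreal ((1 + d) ^ n - 1) * shape_integral n A a e)"
      using that by (simp add: nn_integral_cmult shape_integral_shell[OF n _ fin])
    finally show ?thesis using that by (simp add: ennreal_mult' mult.assoc)
  qed
  have prod_g: "(\<Prod>i=1..n. ennreal (g (x * y i))) = ennreal (\<Prod>i=1..n. g (x * y i))" for y
    using g(2) by (simp add: prod_ennreal)
  show "\<forall>\<^sub>F d in at_right 0. shell_prob n A g x d e \<le>
        ennreal (x ^ n * c ^ n * (1 + eta) * ((1 + d) ^ n - 1)) * shape_integral n A a e"
    if U: "\<And>t. \<bar>t - 1\<bar> \<le> r \<Longrightarrow> g (x * t) \<le> c * exp (b * (t - 1)) * t powr a"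
    using ev
  proof eventually_elim
    case (elim d)
    have d: "0 < d" "d < r / 3" using elim by auto
    have "(\<integral>\<^sup>+y. (\<Prod>i=1..n. ennreal (g (x * y i))) * indicator {..e} (?R y) * indicator {1<..1 + d} (?m y) \<partial>lborel_n n)
      \<le> (\<integral>\<^sup>+y. ennreal ((c ^ n * (1 + eta)) * shape_weight n a y) * indicator {..e} (?R y) * indicator {1<..1 + d} (?m y) \<partial>lborel_n n)"
    proof (intro nn_integral_mono)
      fix y
      have "(\<Prod>i=1..n. g (x * y i)) \<le> c ^ n * (1 + eta) * shape_weight n a y"
        if y: "1 < ?m y" "?m y \<le> 1 + d" "?R y \<le> e"
      proof -
        have pos: "\<forall>i\<in>{1..n}. y i > 0" using y_near[OF y(1,2) d(2) y(3)] r by fastforce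
        have "(\<Prod>i=1..n. g (x * y i)) \<le> (\<Prod>i=1..n. c * exp (b * (y i - 1)) * y i powr a)"
          using y_near[OF y(1,2) d(2) y(3)] g(2) by (intro prod_mono) (auto intro!: U)
        also have "\<dots> = c ^ n * ?E (?m y) * shape_weight n a y" by (rule prod_exp_powr_eq[OF n pos])
        also have "\<dots> \<le> c ^ n * (1 + eta) * shape_weight n a y"
        proof (intro mult_right_mono mult_left_mono shape_weight_nonneg)
          have "\<bar>?E (?m y) - 1\<bar> \<le> eta" using elim y by blast
          thus "?E (?m y) \<le> 1 + eta" by linarith
        qed (use c in auto)
        finally show ?thesis .
      qed
      thus "(\<Prod>i=1..n. ennreal (g (x * y i))) * indicator {..e} (?R y) * indicator {1<..1 + d} (?m y)
        \<le> ennreal ((c ^ n * (1 + eta)) * shape_weight n a y) * indicator {..e} (?R y) * indicator {1<..1 + d} (?m y)"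
        by (auto simp: prod_g indicator_def intro!: ennreal_leI)
    qed
    also have "\<dots> = ennreal ((c ^ n * (1 + eta)) * ((1 + d) ^ n - 1)) * shape_integral n A a e"
      using c eta d by (intro shell) auto
    finally have "shell_prob n A g x d e \<le> ennreal (x ^ n) * (ennreal ((c ^ n * (1 + eta)) * ((1 + d) ^ n - 1)) * shape_integral n A a e)"
      unfolding shell_prob_rescaled[OF g(1) x] by (rule mult_left_mono) simp
    also have "\<dots> = ennreal (x ^ n * c ^ n * (1 + eta) * ((1 + d) ^ n - 1)) * shape_integral n A a e"
      using x by (simp add: mult.assoc ennreal_mult')
    finally show ?case .
  qed
  show "\<forall>\<^sub>F d in at_right 0. shell_prob n A g x d e \<ge>
        ennreal (x ^ n * c ^ n * (1 - eta) * ((1 + d) ^ n - 1)) * shape_integral n A a e"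
    if L: "\<And>t. \<bar>t - 1\<bar> \<le> r \<Longrightarrow> g (x * t) \<ge> c * exp (b * (t - 1)) * t powr a"
    using ev
  proof eventually_elim
    case (elim d)
    have d: "0 < d" "d < r / 3" using elim by auto
    have "(\<integral>\<^sup>+y. ennreal ((c ^ n * (1 - eta)) * shape_weight n a y) * indicator {..e} (?R y) * indicator {1<..1 + d} (?m y) \<partial>lborel_n n)
      \<le> (\<integral>\<^sup>+y. (\<Prod>i=1..n. ennreal (g (x * y i))) * indicator {..e} (?R y) * indicator {1<..1 + d} (?m y) \<partial>lborel_n n)"
    proof (intro nn_integral_mono)
      fix y
      have "c ^ n * (1 - eta) * shape_weight n a y \<le> (\<Prod>i=1..n. g (x * y i))"
        if y: "1 < ?m y" "?m y \<le> 1 + d" "?R y \<le> e"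
      proof -
        have pos: "\<forall>i\<in>{1..n}. y i > 0" using y_near[OF y(1,2) d(2) y(3)] r by fastforce
        have "c ^ n * (1 - eta) * shape_weight n a y \<le> c ^ n * ?E (?m y) * shape_weight n a y"
        proof (intro mult_right_mono mult_left_mono shape_weight_nonneg)
          have "\<bar>?E (?m y) - 1\<bar> \<le> eta" using elim y by blast
          thus "1 - eta \<le> ?E (?m y)" by linarith
        qed (use c in auto)
        also have "\<dots> = (\<Prod>i=1..n. c * exp (b * (y i - 1)) * y i powr a)"
          by (rule prod_exp_powr_eq[OF n pos, symmetric])
        also have "\<dots> \<le> (\<Prod>i=1..n. g (x * y i))"
          using y_near[OF y(1,2) d(2) y(3)] c by (intro prod_mono) (auto intro!: L)
        finally show ?thesis .
      qed
      thus "ennreal ((c ^ n * (1 - eta)) * shape_weight n a y) * indicator {..e} (?R y) * indicator {1<..1 + d} (?m y)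
        \<le> (\<Prod>i=1..n. ennreal (g (x * y i))) * indicator {..e} (?R y) * indicator {1<..1 + d} (?m y)"
        by (auto simp: prod_g indicator_def intro!: ennreal_leI)
    qed
    hence "ennreal (x ^ n) * (ennreal ((c ^ n * (1 - eta)) * ((1 + d) ^ n - 1)) * shape_integral n A a e) \<le> shell_prob n A g x d e"
      unfolding shell_prob_rescaled[OF g(1) x] using c eta d
      by (subst shell[symmetric]) (auto intro!: mult_left_mono)
    moreover have "ennreal (x ^ n) * (ennreal ((c ^ n * (1 - eta)) * ((1 + d) ^ n - 1)) * shape_integral n A a e)
        = ennreal (x ^ n * c ^ n * (1 - eta) * ((1 + d) ^ n - 1)) * shape_integral n A a e"
      using x by (simp add: mult.assoc ennreal_mult')
    ultimately show ?case by simp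
  qed
qed

section \<open>Touching exponents under independence\<close>

text \<open>
  Abstracts the comparison of four shell probabilities, at two base points and for two dispersion
  levels. Independence has written them as products \<open>P * C\<close>, and multiplying crosswise makes all
  unknown probabilities cancel.
\<close>

lemma eliminate_common_factors:
  fixes C C' P1 P2 D1 D2 W Wa Wb p q :: real
  assumes "P1 * C \<le> D1 * p * Wa" "D1 * q ^ (n + 1) * W \<le> P1 * C'"
    and "D2 * q * Wb \<le> P2 * C" "P2 * C' \<le> D2 * p ^ (n + 1) * W"
    and "C \<ge> 0" "C' \<ge> 0" "P1 \<ge> 0" "P2 \<ge> 0" "D1 > 0" "D2 > 0" "W > 0" "Wb \<ge> 0" "q \<ge> 0"
  shows "q ^ (n + 2) * Wb \<le> p ^ (n + 2) * Wa"
proof -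
  have "(D1 * q ^ (n + 1) * W) * (D2 * q * Wb) \<le> (P1 * C') * (P2 * C)"
    using assms by (intro mult_mono[OF assms(2,3)]) auto
  also have "\<dots> = (P1 * C) * (P2 * C')" by simp
  also have "\<dots> \<le> (D1 * p * Wa) * (D2 * p ^ (n + 1) * W)"
    using assms order_trans[OF _ assms(1), of 0] by (intro mult_mono[OF assms(1,4)]) auto
  finally have "(D1 * D2 * W) * (q ^ (n + 2) * Wb) \<le> (D1 * D2 * W) * (p ^ (n + 2) * Wa)"
    by (simp add: mult_ac power_add power2_eq_square)
  thus ?thesis using assms by simp
qed

lemma relative_continuity:
  fixes g :: "real \<Rightarrow> real"
  assumes cont: "continuous_on {0<..} g" and x: "x > 0" "g x > 0" and eta: "eta > 0"
  shows "\<exists>s>0. s \<le> 1 / 2 \<and> (\<forall>t. \<bar>t - 1\<bar> \<le> s \<longrightarrow> g x * (1 - eta) \<le> g (x * t) \<and> g (x * t) \<le> g x * (1 + eta))"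
    (is "\<exists>s>0. _ \<and> ?P s")
proof -
  have "isCont g x" using cont x by (simp add: continuous_on_eq_continuous_at)
  then obtain r where r: "r > 0" "\<And>z. dist z x < r \<Longrightarrow> dist (g z) (g x) < eta * g x"
    using eta x unfolding continuous_at_eps_delta by (metis mult_pos_pos)
  define s where "s = min (1 / 2) (r / (2 * x))"
  have "g x * (1 - eta) \<le> g (x * t) \<and> g (x * t) \<le> g x * (1 + eta)" if "\<bar>t - 1\<bar> \<le> s" for t
  proof -
    have "\<bar>x * t - x\<bar> = x * \<bar>t - 1\<bar>" using x abs_mult[of x "t - 1"] by (simp add: algebra_simps)
    also have "\<dots> \<le> x * (r / (2 * x))" using that x by (intro mult_left_mono) (auto simp: s_def)
    also have "\<dots> < r" using x r by simp
    finally have "\<bar>g (x * t) - g x\<bar> < eta * g x" using r(2)[of "x * t"] by (simp add: dist_real_def)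
    thus ?thesis by (simp add: algebra_simps abs_less_iff)
  qed
  moreover have "s > 0" "s \<le> 1 / 2" using x r by (auto simp: s_def)
  ultimately show ?thesis by blast
qed

lemma touched_above_exp:
  assumes touch: "touched_above L a"
  obtains b x r where "x > 0" "0 < r" "r \<le> 1 / 2"
    "\<And>t. \<bar>t - 1\<bar> \<le> r \<Longrightarrow> exp (L (x * t)) \<le> exp (L x) * exp (b * (t - 1)) * t powr a"
proof -
  obtain b x r where *: "x > 0" "0 < r" "\<And>t. \<bar>t - 1\<bar> \<le> r \<Longrightarrow> L (x * t) - L x \<le> b * (t - 1) + a * ln t"
    using touch unfolding touched_above_def by blast
  show ?thesis
  proof (rule that[of x "min r (1 / 2)" b])
    fix t assume t: "\<bar>t - 1\<bar> \<le> min r (1 / 2)"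
    hence "t > 0" by linarith
    have "exp (L (x * t)) \<le> exp (L x + b * (t - 1) + a * ln t)" using *(3)[of t] t by simp
    thus "exp (L (x * t)) \<le> exp (L x) * exp (b * (t - 1)) * t powr a"
      using \<open>t > 0\<close> by (simp add: exp_add powr_def)
  qed (use * in auto)
qed

text \<open>
  Let \<open>x\<close> and \<open>x'\<close> be the points of touching from above and from below. At a fixed dispersion level
  \<open>e\<close> the touching curves bound the shell probabilities at \<open>x\<close> from above and at \<open>x'\<close> from below. The
  unknown normalisation is removed by comparing with a much smaller level \<open>e'\<close>, where continuity of \<open>g\<close>
  alone determines the shell probabilities up to a factor close to 1.
\<close>

lemma touching_exponents_ordered_if_independent:
  assumes n: "n \<ge> 2" and A: "positive_definite n A"
    and g: "g \<in> borel_measurable borel" "\<And>x. g x \<ge> 0" "\<And>x. x \<le> 0 \<Longrightarrow> g x = 0"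
    and g_pos: "\<And>x. x > 0 \<Longrightarrow> g x > 0" and cont: "continuous_on {0<..} g"
    and prob: "prob_space (sample_law n g)"
    and indep: "\<And>S B. S \<in> sets borel \<Longrightarrow> B \<in> sets borel \<Longrightarrow>
      emeasure (sample_law n g) {y \<in> space (sample_law n g). sample_mean n y \<in> S \<and> root_Z_over_mean n A y \<in> B} =
      emeasure (sample_law n g) {y \<in> space (sample_law n g). sample_mean n y \<in> S} *
      emeasure (sample_law n g) {y \<in> space (sample_law n g). root_Z_over_mean n A y \<in> B}"
    and above: "touched_above (\<lambda>x. ln (g x)) a" and below: "touched_above (\<lambda>x. - ln (g x)) (- a')"
  shows "a \<le> a'"
proof (rule ccontr)
  assume "\<not> a \<le> a'"
  hence less: "a' < a" by simp
  interpret L: prob_space "sample_law n g" by (rule prob)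
  have n0: "n > 0" using n by simp
  obtain K where K: "K > 0" and near: "\<And>y e i. sample_mean n y > 0 \<Longrightarrow> root_Z_over_mean n A y \<le> e \<Longrightarrow>
      i \<in> {1..n} \<Longrightarrow> \<bar>y i / sample_mean n y - 1\<bar> \<le> K * e"
    using root_Z_over_mean_controls_deviation[OF A n0] by blast
  have near': "\<bar>y i / sample_mean n y - 1\<bar> \<le> r / 3"
    if "sample_mean n y > 0" "root_Z_over_mean n A y \<le> e" "i \<in> {1..n}" "e \<le> r / (3 * K)" for y e i r
  proof -
    have "K * e \<le> r / 3" using K that(4) by (simp add: field_simps)
    with near[OF that(1-3)] show ?thesis by linarith
  qed
  have fin: "shape_integral n A c e < \<top>" if "e \<le> r / (3 * K)" "r \<le> 1 / 2" for c e r
    using near' that by (intro shape_integral_finite[OF n0]) fastforce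
  define W where "W c e = enn2real (shape_integral n A c e)" for c e
  have W: "shape_integral n A c e = ennreal (W c e)" "W c e \<ge> 0" if "e \<le> r / (3 * K)" "r \<le> 1 / 2" for c e r
    using fin[OF that] by (auto simp: W_def)
  have W_less: "W d e < W c e" if "c < d" "0 < e" "e \<le> r / (3 * K)" "r \<le> 1 / 2" for c d e r
    using shape_integral_strict_antimono[OF n that(2,1) fin[OF that(3,4)]] W[OF that(3,4)]
    by (simp add: ennreal_less_iff)
  define P where "P x d = measure (sample_law n g)
      {y \<in> space (sample_law n g). sample_mean n y \<in> {x<..x * (1 + d)}}" for x d
  define C where "C e = measure (sample_law n g)
      {y \<in> space (sample_law n g). root_Z_over_mean n A y \<in> {..e}}" for e
  have shell: "shell_prob n A g x d e = ennreal (P x d * C e)" for x d e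
    unfolding shell_prob_def P_def C_def
    by (subst indep) (simp_all add: L.emeasure_eq_measure ennreal_mult')
  have upper: "\<forall>\<^sub>F d in at_right 0. P x d * C e \<le> x ^ n * c ^ n * (1 + eta) * ((1 + d) ^ n - 1) * W s e"
    if "x > 0" "0 < r" "r \<le> 1 / 2" "c \<ge> 0" "0 < eta" "eta < 1" "e \<le> r / (3 * K)"
      and U: "\<And>t. \<bar>t - 1\<bar> \<le> r \<Longrightarrow> g (x * t) \<le> c * exp (b * (t - 1)) * t powr s" for x r c eta e s b
  proof -
    have "\<forall>\<^sub>F d in at_right 0. shell_prob n A g x d e \<le>
        ennreal (x ^ n * c ^ n * (1 + eta) * ((1 + d) ^ n - 1)) * shape_integral n A s e"
      using that near' fin[OF that(7,3)] by (intro shell_prob_bounds(1)[OF n0 g, where r = r and b = b]) auto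
    moreover have "\<forall>\<^sub>F d in at_right (0::real). d > 0" by (rule eventually_at_right_less)
    ultimately show ?thesis
    proof eventually_elim
      case (elim d)
      have "x ^ n * c ^ n * (1 + eta) * ((1 + d) ^ n - 1) * W s e \<ge> 0"
        using that elim W(2)[OF that(7,3)] by (intro mult_nonneg_nonneg) auto
      with elim show ?case using W(2)[OF that(7,3)]
        by (simp add: shell W(1)[OF that(7,3)] ennreal_mult''[symmetric])
    qed
  qed
  have lower: "\<forall>\<^sub>F d in at_right 0. P x d * C e \<ge> x ^ n * c ^ n * (1 - eta) * ((1 + d) ^ n - 1) * W s e"
    if "x > 0" "0 < r" "r \<le> 1 / 2" "c \<ge> 0" "0 < eta" "eta < 1" "e \<le> r / (3 * K)"
      and U: "\<And>t. \<bar>t - 1\<bar> \<le> r \<Longrightarrow> g (x * t) \<ge> c * exp (b * (t - 1)) * t powr s" for x r c eta e s b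
  proof -
    have "\<forall>\<^sub>F d in at_right 0. shell_prob n A g x d e \<ge>
        ennreal (x ^ n * c ^ n * (1 - eta) * ((1 + d) ^ n - 1)) * shape_integral n A s e"
      using that near' fin[OF that(7,3)] by (intro shell_prob_bounds(2)[OF n0 g, where r = r and b = b]) auto
    thus ?thesis
    proof eventually_elim
      case (elim d)
      thus ?case using W(2)[OF that(7,3)]
        by (simp add: shell W(1)[OF that(7,3)] ennreal_mult''[symmetric] P_def C_def)
    qed
  qed
  obtain b x r where x: "x > 0" "0 < r" "r \<le> 1 / 2"
    and U: "\<And>t. \<bar>t - 1\<bar> \<le> r \<Longrightarrow> g (x * t) \<le> g x * exp (b * (t - 1)) * t powr a"
  proof (rule touched_above_exp[OF above])
    fix b x r assume *: "x > 0" "0 < r" "r \<le> 1 / 2"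
      and U: "\<And>t. \<bar>t - 1\<bar> \<le> r \<Longrightarrow> exp (ln (g (x * t))) \<le> exp (ln (g x)) * exp (b * (t - 1)) * t powr a"
    show thesis
    proof (rule that[OF *])
      fix t assume t: "\<bar>t - 1\<bar> \<le> r"
      hence "t > 0" using * by linarith
      thus "g (x * t) \<le> g x * exp (b * (t - 1)) * t powr a" using U[OF t] g_pos * by simp
    qed
  qed
  obtain b' x' r' where x': "x' > 0" "0 < r'" "r' \<le> 1 / 2"
    and L: "\<And>t. \<bar>t - 1\<bar> \<le> r' \<Longrightarrow> g (x' * t) \<ge> g x' * exp (b' * (t - 1)) * t powr a'"
  proof (rule touched_above_exp[OF below])
    fix b x r assume *: "x > 0" "0 < r" "r \<le> 1 / 2"
      and U: "\<And>t. \<bar>t - 1\<bar> \<le> r \<Longrightarrow> exp (- ln (g (x * t))) \<le> exp (- ln (g x)) * exp (b * (t - 1)) * t powr - a'"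
    show thesis
    proof (rule that[OF *])
      fix t assume t: "\<bar>t - 1\<bar> \<le> r"
      hence t0: "t > 0" using * by linarith
      have "1 / g (x * t) \<le> 1 / (g x * exp (- b * (t - 1)) * t powr a')"
        using U[OF t] g_pos * t0 by (simp add: exp_minus powr_minus divide_simps mult_ac)
      thus "g (x * t) \<ge> g x * exp (- b * (t - 1)) * t powr a'"
        using g_pos * t0 by (simp add: divide_simps)
    qed
  qed
  \<comment> \<open>Relative deviations are at most \<open>K * e\<close>, and the shell bounds require them to be at most a third of
    the radius.\<close>
  define e where "e = min r r' / (3 * K)"
  have e: "e > 0" "e \<le> r / (3 * K)" "e \<le> r' / (3 * K)"
    using K x x' by (auto simp: e_def intro!: divide_right_mono)
  have key: "(1 - eta) ^ (n + 2) * W a' e \<le> (1 + eta) ^ (n + 2) * W a e" if eta: "0 < eta" "eta < 1" for eta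
  proof -
    obtain s where s: "s > 0" "s \<le> 1 / 2"
      "\<And>t. \<bar>t - 1\<bar> \<le> s \<Longrightarrow> g x * (1 - eta) \<le> g (x * t)"
      using relative_continuity[OF cont x(1) g_pos[OF x(1)] eta(1)] by blast
    obtain s' where s': "s' > 0" "s' \<le> 1 / 2"
      "\<And>t. \<bar>t - 1\<bar> \<le> s' \<Longrightarrow> g (x' * t) \<le> g x' * (1 + eta)"
      using relative_continuity[OF cont x'(1) g_pos[OF x'(1)] eta(1)] by blast
    \<comment> \<open>At this level the exponent 0 suffices on both sides, with \<open>g\<close> replaced by constants.\<close>
    define e' where "e' = min s s' / (3 * K)"
    have e': "e' > 0" "e' \<le> s / (3 * K)" "e' \<le> s' / (3 * K)"
      using K s s' by (auto simp: e'_def intro!: divide_right_mono)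
    have g0: "g x > 0" "g x' > 0" using g_pos x x' by auto
    have "\<forall>\<^sub>F d in at_right (0::real). d > 0 \<and>
       P x d * C e \<le> x ^ n * g x ^ n * (1 + eta) * ((1 + d) ^ n - 1) * W a e \<and>
       P x d * C e' \<ge> x ^ n * (g x * (1 - eta)) ^ n * (1 - eta) * ((1 + d) ^ n - 1) * W 0 e' \<and>
       P x' d * C e \<ge> x' ^ n * g x' ^ n * (1 - eta) * ((1 + d) ^ n - 1) * W a' e \<and>
       P x' d * C e' \<le> x' ^ n * (g x' * (1 + eta)) ^ n * (1 + eta) * ((1 + d) ^ n - 1) * W 0 e'"
    proof (intro eventually_conj)
      show "\<forall>\<^sub>F d in at_right 0. P x d * C e \<le> x ^ n * g x ^ n * (1 + eta) * ((1 + d) ^ n - 1) * W a e"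
        using x e eta g0 U by (intro upper[of x r _ _ _ b]) auto
      show "\<forall>\<^sub>F d in at_right 0. P x d * C e' \<ge> x ^ n * (g x * (1 - eta)) ^ n * (1 - eta) * ((1 + d) ^ n - 1) * W 0 e'"
        using x s e' eta g0 by (intro lower[of x s _ _ _ 0]) (auto simp: abs_le_iff)
      show "\<forall>\<^sub>F d in at_right 0. P x' d * C e \<ge> x' ^ n * g x' ^ n * (1 - eta) * ((1 + d) ^ n - 1) * W a' e"
        using x' e eta g0 L by (intro lower[of x' r' _ _ _ b']) auto
      show "\<forall>\<^sub>F d in at_right 0. P x' d * C e' \<le> x' ^ n * (g x' * (1 + eta)) ^ n * (1 + eta) * ((1 + d) ^ n - 1) * W 0 e'"
        using x' s' e' eta g0 by (intro upper[of x' s' _ _ _ 0]) (auto simp: abs_le_iff)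
    qed (rule eventually_at_right_less)
    then obtain d where d: "d > 0"
       "P x d * C e \<le> x ^ n * g x ^ n * (1 + eta) * ((1 + d) ^ n - 1) * W a e"
       "P x d * C e' \<ge> x ^ n * (g x * (1 - eta)) ^ n * (1 - eta) * ((1 + d) ^ n - 1) * W 0 e'"
       "P x' d * C e \<ge> x' ^ n * g x' ^ n * (1 - eta) * ((1 + d) ^ n - 1) * W a' e"
       "P x' d * C e' \<le> x' ^ n * (g x' * (1 + eta)) ^ n * (1 + eta) * ((1 + d) ^ n - 1) * W 0 e'"
      using eventually_happens[of _ "at_right (0::real)"] trivial_limit_at_right_real by blast
    have v: "(1 + d) ^ n - 1 > 0" using d(1) n0 by (simp add: one_less_power)
    have W0: "W 0 e' > 0" using W_less[of 0 1 e' s] W(2)[of e' s 1] e' s by linarith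
    show ?thesis
    proof (rule eliminate_common_factors)
      show "P x d * C e \<le> (x ^ n * g x ^ n * ((1 + d) ^ n - 1)) * (1 + eta) * W a e"
        "(x ^ n * g x ^ n * ((1 + d) ^ n - 1)) * (1 - eta) ^ (n + 1) * W 0 e' \<le> P x d * C e'"
        "(x' ^ n * g x' ^ n * ((1 + d) ^ n - 1)) * (1 - eta) * W a' e \<le> P x' d * C e"
        "P x' d * C e' \<le> (x' ^ n * g x' ^ n * ((1 + d) ^ n - 1)) * (1 + eta) ^ (n + 1) * W 0 e'"
        using d by (simp_all add: power_mult_distrib power_add mult_ac)
    qed (use W0 v x x' g0 eta W(2)[OF e(2) x(3)] in \<open>auto simp: P_def C_def\<close>)
  qed
  have "W a' e \<le> W a e"
  proof (rule tendsto_le)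
    show "((\<lambda>eta. (1 + eta) ^ (n + 2) * W a e) \<longlongrightarrow> W a e) (at_right 0)"
      by (rule tendsto_eq_intros refl | simp)+
    show "((\<lambda>eta. (1 - eta) ^ (n + 2) * W a' e) \<longlongrightarrow> W a' e) (at_right 0)"
      by (rule tendsto_eq_intros refl | simp)+
    show "\<forall>\<^sub>F eta in at_right 0. (1 - eta) ^ (n + 2) * W a' e \<le> (1 + eta) ^ (n + 2) * W a e"
      using eventually_at_right_real[OF zero_less_one] by (rule eventually_mono) (rule key; simp)
  qed simp
  with W_less[OF less e(1,2) x(3)] show False by simp
qed

section \<open>Identification of the gamma distribution\<close>

lemma nn_integral_inverse_Icc:
  assumes "0 < p" "p \<le> q"
  shows "(\<integral>\<^sup>+x. ennreal (1 / x) * indicator {p..q} x \<partial>lborel) = ennreal (ln q - ln p)"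
  using assms by (intro nn_integral_FTC_Icc) (auto intro!: derivative_eq_intros simp: field_simps)

text \<open>
  Otherwise \<open>h\<close> would dominate a multiple of \<open>1 / x\<close> on \<open>(0, 1]\<close> or on \<open>[1, \<infinity>)\<close>; on each of them
  there are intervals over which \<open>1 / x\<close> has integral \<open>N\<close>, for every \<open>N\<close>.
\<close>

lemma powr_exp_integrable_imp:
  fixes h :: "real \<Rightarrow> real"
  assumes h: "\<And>x. x > 0 \<Longrightarrow> h x = k * x powr a * exp (b * x)" and k: "k > 0" and C: "C \<ge> 0"
    and int: "(\<integral>\<^sup>+x. ennreal (h x) \<partial>lborel) \<le> ennreal C"
  shows "a > -1" "b < 0"
proof -
  have no_inverse: False
    if c: "c > 0" and p: "\<And>N. 0 < p N \<and> p N \<le> q N \<and> ln (q N) - ln (p N) = (N::nat)"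
      and le: "\<And>N x. p N \<le> x \<Longrightarrow> x \<le> q N \<Longrightarrow> c / x \<le> h x" for c p q
  proof -
    have "c * N \<le> C" for N :: nat
    proof -
      have "ennreal (c * N) = ennreal c * (\<integral>\<^sup>+x. ennreal (1 / x) * indicator {p N..q N} x \<partial>lborel)"
        using c p[of N] by (subst nn_integral_inverse_Icc) (auto simp: ennreal_mult')
      also have "\<dots> = (\<integral>\<^sup>+x. ennreal c * (ennreal (1 / x) * indicator {p N..q N} x) \<partial>lborel)"
        by (intro nn_integral_cmult[symmetric]) auto
      also have "\<dots> \<le> (\<integral>\<^sup>+x. ennreal (h x) \<partial>lborel)"
        using c le[of N] by (intro nn_integral_mono)
          (auto simp: indicator_def ennreal_mult'[symmetric] intro!: ennreal_leI)
      also have "\<dots> \<le> ennreal C" by (rule int)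
      finally show ?thesis using C by (simp add: ennreal_le_iff)
    qed
    moreover obtain N :: nat where "N > C / c" using reals_Archimedean2 by blast
    ultimately show False using c by (metis divide_less_eq mult.commute not_le)
  qed
  show "a > -1"
  proof (rule ccontr)
    assume a: "\<not> a > -1"
    show False
    proof (rule no_inverse[of "k * exp (- \<bar>b\<bar>)" "\<lambda>N. exp (- real N)" "\<lambda>_. 1"])
      fix N :: nat and x :: real assume x: "exp (- real N) \<le> x" "x \<le> 1"
      hence x0: "x > 0" by (meson exp_gt_zero less_le_trans)
      have "\<bar>b * x\<bar> \<le> \<bar>b\<bar> * 1" unfolding abs_mult using x x0 by (intro mult_left_mono) auto
      hence "exp (- \<bar>b\<bar>) \<le> exp (b * x)" by simp
      moreover have "x powr (-1) \<le> x powr a" using a x x0 by (intro powr_mono') auto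
      ultimately have "k * (x powr (-1) * exp (- \<bar>b\<bar>)) \<le> k * (x powr a * exp (b * x))"
        using k by (intro mult_left_mono mult_mono) auto
      thus "k * exp (- \<bar>b\<bar>) / x \<le> h x" using x0 by (simp add: h powr_minus divide_simps mult_ac)
    qed (use k in auto)
  qed
  show "b < 0"
  proof (rule ccontr)
    assume b: "\<not> b < 0"
    show False
    proof (rule no_inverse[of k "\<lambda>N. 1" "\<lambda>N. exp (real N)"])
      fix N :: nat and x :: real assume x: "1 \<le> x" "x \<le> exp (real N)"
      have "x powr (-1) \<le> x powr a" using \<open>a > -1\<close> x by (intro powr_mono) auto
      moreover have "1 \<le> exp (b * x)" using b x by simp
      ultimately have "k * (x powr (-1) * 1) \<le> k * (x powr a * exp (b * x))"
        using k by (intro mult_left_mono mult_mono) auto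
      thus "k / x \<le> h x" using x by (simp add: h powr_minus divide_simps mult_ac)
    qed (use k in auto)
  qed
qed

lemma measurable_gamma_density [measurable]: "gamma_density a b \<in> borel_measurable borel"
  unfolding gamma_density_def by measurable

lemma nn_integral_gamma_density:
  assumes a: "a > 0" and b: "b > 0"
  shows "(\<integral>\<^sup>+x. ennreal (gamma_density a b x) \<partial>lborel) = 1"
proof -
  have G: "Gamma a > 0" using a by (rule Gamma_real_pos)
  have eq: "(1 / b) * (indicator {0..} (0 + (1 / b) * x) * (0 + (1 / b) * x) powr (a - 1) / exp (0 + (1 / b) * x))
      = Gamma a * gamma_density a b x" for x
  proof (cases "x > 0")
    case True
    have "(x / b) powr (a - 1) = x powr (a - 1) * b / b powr a"
      using True b by (simp add: powr_divide powr_diff)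
    thus ?thesis using True b G by (simp add: gamma_density_def exp_minus divide_simps)
  next
    case False
    thus ?thesis using b by (cases "x = 0") (auto simp: gamma_density_def indicator_def zero_le_divide_iff)
  qed
  have "ennreal (Gamma a) = (\<integral>\<^sup>+t. ennreal (indicator {0..} t * t powr (a - 1) / exp t) \<partial>lborel)"
    by (rule Gamma_conv_nn_integral_real[OF a])
  also have "\<dots> = ennreal \<bar>1 / b\<bar> * (\<integral>\<^sup>+x. ennreal (indicator {0..} (0 + (1 / b) * x) * (0 + (1 / b) * x) powr (a - 1) / exp (0 + (1 / b) * x)) \<partial>lborel)"
    using b by (intro nn_integral_real_affine) auto
  also have "\<dots> = (\<integral>\<^sup>+x. ennreal ((1 / b) * (indicator {0..} (0 + (1 / b) * x) * (0 + (1 / b) * x) powr (a - 1) / exp (0 + (1 / b) * x))) \<partial>lborel)"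
    using b by (subst nn_integral_cmult[symmetric]) (auto simp: ennreal_mult'[symmetric])
  also have "\<dots> = (\<integral>\<^sup>+x. ennreal (Gamma a) * ennreal (gamma_density a b x) \<partial>lborel)"
    unfolding eq using G by (simp add: ennreal_mult')
  also have "\<dots> = ennreal (Gamma a) * (\<integral>\<^sup>+x. ennreal (gamma_density a b x) \<partial>lborel)"
    by (intro nn_integral_cmult) auto
  finally have "ennreal (Gamma a) * 1 = ennreal (Gamma a) * (\<integral>\<^sup>+x. ennreal (gamma_density a b x) \<partial>lborel)" by simp
  thus ?thesis using G by (subst (asm) ennreal_mult_cancel_left) auto
qed

text \<open>
  Integrability yields the ranges of the parameters; the constant is then determined because both
  densities have total mass 1.
\<close>

lemma gamma_distribution_if_log_affine:
  assumes g: "g \<in> borel_measurable borel" "\<And>x. x > 0 \<Longrightarrow> g x > 0" "\<And>x. x \<le> 0 \<Longrightarrow> g x = 0"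
    and prob: "prob_space (density lborel g)"
    and L: "\<And>x. x > 0 \<Longrightarrow> ln (g x) = a * ln x + b * x + c"
  shows "gamma_distribution (density lborel g)"
proof -
  have g_eq: "g x = exp c * x powr a * exp (b * x)" if "x > 0" for x
  proof -
    have "g x = exp (ln (g x))" using g(2)[OF that] by simp
    thus ?thesis using that by (simp add: L exp_add powr_def mult_ac)
  qed
  have total: "(\<integral>\<^sup>+x. ennreal (g x) \<partial>lborel) = 1"
    using prob_space.emeasure_space_1[OF prob] g(1) by (simp add: emeasure_density)
  have a: "a > -1" and b: "b < 0"
    using powr_exp_integrable_imp[of g "exp c" a b 1] g_eq total by auto
  define k where "k = exp c * (Gamma (a + 1) * (- 1 / b) powr (a + 1))"
  have G: "Gamma (a + 1) > 0" "(- 1 / b) powr (a + 1) > 0" using a b by (auto intro!: Gamma_real_pos)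
  have g_gamma: "g x = k * gamma_density (a + 1) (- 1 / b) x" for x
    using G g(3)[of x] b by (cases "x > 0") (auto simp: g_eq k_def gamma_density_def)
  have k: "k > 0" using G by (simp add: k_def)
  have "1 = (\<integral>\<^sup>+x. ennreal k * ennreal (gamma_density (a + 1) (- 1 / b) x) \<partial>lborel)"
    using total k by (simp add: g_gamma ennreal_mult')
  also have "\<dots> = ennreal k * (\<integral>\<^sup>+x. ennreal (gamma_density (a + 1) (- 1 / b) x) \<partial>lborel)"
    by (intro nn_integral_cmult) auto
  also have "\<dots> = ennreal k" using a b by (subst nn_integral_gamma_density) auto
  finally have "k = 1" using k by simp
  hence "g = gamma_density (a + 1) (- 1 / b)" by (simp add: g_gamma fun_eq_iff)
  thus ?thesis unfolding gamma_distribution_def using a b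
    by (intro exI[of _ "a + 1"] exI[of _ "- 1 / b"] conjI) (auto simp: divide_neg_neg)
qed

section \<open>The characterisation\<close>

lemma distr_iid_sample:
  assumes M: "prob_space M" and n: "n > 0"
    and indep: "prob_space.indep_vars M (\<lambda>_. borel) X {1..n}"
    and F: "\<And>i. i \<in> {1..n} \<Longrightarrow> distr M borel (X i) = density lborel (\<lambda>x. ennreal (g x))"
    and g: "g \<in> borel_measurable borel"
  shows "distr M (\<Pi>\<^sub>M i\<in>{1..n}. borel) (\<lambda>\<omega>. \<lambda>i\<in>{1..n}. X i \<omega>) = sample_law n g"
    and "prob_space (density lborel g)"
proof -
  interpret prob_space M by (rule M)
  have rv: "random_variable borel (X i)" if "i \<in> {1..n}" for i
    using indep that by (auto simp: indep_vars_def)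
  have "prob_space (distr M borel (X 1))" using rv[of 1] n by (intro prob_space_distr) auto
  thus prob: "prob_space (density lborel g)" using F[of 1] n by simp
  have "distr M (\<Pi>\<^sub>M i\<in>{1..n}. borel) (\<lambda>\<omega>. \<lambda>i\<in>{1..n}. X i \<omega>) = (\<Pi>\<^sub>M i\<in>{1..n}. distr M borel (X i))"
    using indep_vars_iff_distr_eq_PiM'[where I = "{1..n}" and M' = "\<lambda>_. borel" and X = X] indep rv n by auto
  also have "\<dots> = (\<Pi>\<^sub>M i\<in>{1..n}. density lborel g)" using F by (intro PiM_cong) auto
  also have "\<dots> = sample_law n g"
    unfolding sample_law_def using g prob by (intro PiM_density_lborel) auto
  finally show "distr M (\<Pi>\<^sub>M i\<in>{1..n}. borel) (\<lambda>\<omega>. \<lambda>i\<in>{1..n}. X i \<omega>) = sample_law n g" .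
qed

lemma (in prob_space) indep_var_iff_emeasure:
  fixes U V :: "'a \<Rightarrow> real"
  assumes [measurable]: "random_variable borel U" "random_variable borel V"
  shows "indep_var borel U borel V \<longleftrightarrow> (\<forall>S\<in>sets borel. \<forall>B\<in>sets borel.
    emeasure M {\<omega> \<in> space M. U \<omega> \<in> S \<and> V \<omega> \<in> B} =
    emeasure M {\<omega> \<in> space M. U \<omega> \<in> S} * emeasure M {\<omega> \<in> space M. V \<omega> \<in> B})"
    (is "_ \<longleftrightarrow> ?R")
proof -
  interpret U: prob_space "distr M borel U" by (rule prob_space_distr) fact
  interpret V: prob_space "distr M borel V" by (rule prob_space_distr) fact
  interpret UV: pair_sigma_finite "distr M borel U" "distr M borel V" ..
  have joint: "emeasure (distr M (borel \<Otimes>\<^sub>M borel) (\<lambda>\<omega>. (U \<omega>, V \<omega>))) (S \<times> B) = emeasure M {\<omega> \<in> space M. U \<omega> \<in> S \<and> V \<omega> \<in> B}"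
    if [measurable]: "S \<in> sets borel" "B \<in> sets borel" for S B
    by (subst emeasure_distr) (auto intro!: arg_cong[where f = "emeasure M"])
  have marg: "emeasure (distr M borel U) S = emeasure M {\<omega> \<in> space M. U \<omega> \<in> S}"
     "emeasure (distr M borel V) S = emeasure M {\<omega> \<in> space M. V \<omega> \<in> S}" if [measurable]: "S \<in> sets borel" for S
    by (auto simp: emeasure_distr intro!: arg_cong[where f = "emeasure M"])
  have "?R \<longleftrightarrow> distr M borel U \<Otimes>\<^sub>M distr M borel V = distr M (borel \<Otimes>\<^sub>M borel) (\<lambda>\<omega>. (U \<omega>, V \<omega>))"
  proof
    assume R: ?R
    show "distr M borel U \<Otimes>\<^sub>M distr M borel V = distr M (borel \<Otimes>\<^sub>M borel) (\<lambda>\<omega>. (U \<omega>, V \<omega>))"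
    proof (rule pair_measure_eqI)
      show "sets (distr M borel U \<Otimes>\<^sub>M distr M borel V) = sets (distr M (borel \<Otimes>\<^sub>M borel) (\<lambda>\<omega>. (U \<omega>, V \<omega>)))"
        by (simp cong: sets_pair_measure_cong)
    qed (use R in \<open>auto simp: joint marg U.sigma_finite_measure_axioms V.sigma_finite_measure_axioms\<close>)
  next
    assume eq: "distr M borel U \<Otimes>\<^sub>M distr M borel V = distr M (borel \<Otimes>\<^sub>M borel) (\<lambda>\<omega>. (U \<omega>, V \<omega>))"
    show ?R
    proof (intro ballI)
      fix S B :: "real set" assume SB: "S \<in> sets borel" "B \<in> sets borel"
      have "emeasure M {\<omega> \<in> space M. U \<omega> \<in> S \<and> V \<omega> \<in> B} = emeasure (distr M borel U \<Otimes>\<^sub>M distr M borel V) (S \<times> B)"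
        unfolding eq by (rule joint[OF SB, symmetric])
      also have "\<dots> = emeasure (distr M borel U) S * emeasure (distr M borel V) B"
        using SB by (intro V.emeasure_pair_measure_Times) auto
      finally show "emeasure M {\<omega> \<in> space M. U \<omega> \<in> S \<and> V \<omega> \<in> B} =
          emeasure M {\<omega> \<in> space M. U \<omega> \<in> S} * emeasure M {\<omega> \<in> space M. V \<omega> \<in> B}"
        using SB by (simp add: marg)
    qed
  qed
  thus ?thesis unfolding indep_var_distribution_eq by simp
qed

theorem corollary6:
  fixes M :: "'a measure" and X :: "nat \<Rightarrow> 'a \<Rightarrow> real" and F :: "real measure"
    and f :: "real \<Rightarrow> real" and A :: "nat \<Rightarrow> nat \<Rightarrow> real" and n :: nat
  assumes "prob_space M"
    and "n \<ge> 3"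
    and "prob_space.indep_vars M (\<lambda>_. borel) X {1..n}"
    and "\<And>i. i \<in> {1..n} \<Longrightarrow> distr M borel (X i) = F"
    and "\<And>i. i \<in> {1..n} \<Longrightarrow> AE \<omega> in M. X i \<omega> > 0"
    and "f \<in> borel_measurable borel"
    and "\<And>x. f x \<ge> 0"
    and "F = density lborel (\<lambda>x. ennreal (f x))"
    and "\<And>x. x > 0 \<Longrightarrow> f x > 0"
    and "continuous_on {0<..} f"
    and "positive_definite n A"
  shows "prob_space.indep_var M
           borel (\<lambda>\<omega>. sample_mean n (\<lambda>i. X i \<omega>))
           borel (\<lambda>\<omega>. sqrt (Z_statistic n A (\<lambda>i. X i \<omega>)) / sample_mean n (\<lambda>i. X i \<omega>))
         \<longleftrightarrow> gamma_distribution F"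
proof -
  interpret prob_space M by (rule assms(1))
  have n0: "n > 0" and n2: "n \<ge> 2" using assms(2) by auto
  have rv [measurable]: "random_variable borel (X i)" if "i \<in> {1..n}" for i
    using assms(3) that by (auto simp: indep_vars_def)
  let ?X = "\<lambda>\<omega>. \<lambda>i\<in>{1..n}. X i \<omega>"
  have X [measurable]: "?X \<in> M \<rightarrow>\<^sub>M (\<Pi>\<^sub>M i\<in>{1..n}. borel)" using rv by (intro measurable_restrict) auto
  define U where "U \<omega> = sample_mean n (\<lambda>i. X i \<omega>)" for \<omega>
  define V where "V \<omega> = sqrt (Z_statistic n A (\<lambda>i. X i \<omega>)) / sample_mean n (\<lambda>i. X i \<omega>)" for \<omega>
  have U_eq: "U \<omega> = sample_mean n (?X \<omega>)" for \<omega> unfolding U_def by (rule sample_mean_cong) auto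
  have V_eq: "V \<omega> = root_Z_over_mean n A (?X \<omega>)" for \<omega>
  proof -
    have "Z_statistic n A (\<lambda>i. X i \<omega>) = Z_statistic n A (?X \<omega>)" by (rule Z_statistic_cong) auto
    thus ?thesis using U_eq[of \<omega>] by (simp add: V_def U_def root_Z_over_mean_def)
  qed
  have [measurable]: "random_variable borel U" "random_variable borel V"
    unfolding U_eq V_eq by measurable
  have transfer: "indep_var borel U borel V \<longleftrightarrow> (\<forall>S\<in>sets borel. \<forall>B\<in>sets borel.
      emeasure (sample_law n h) {y \<in> space (sample_law n h). sample_mean n y \<in> S \<and> root_Z_over_mean n A y \<in> B} =
      emeasure (sample_law n h) {y \<in> space (sample_law n h). sample_mean n y \<in> S} *
      emeasure (sample_law n h) {y \<in> space (sample_law n h). root_Z_over_mean n A y \<in> B})"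
    if law: "distr M (\<Pi>\<^sub>M i\<in>{1..n}. borel) ?X = sample_law n h" for h
  proof -
    have em: "emeasure (sample_law n h) {y \<in> space (sample_law n h). Q y} = emeasure M {\<omega> \<in> space M. Q (?X \<omega>)}"
      if "Measurable.pred (\<Pi>\<^sub>M i\<in>{1..n}. borel) Q" for Q
    proof -
      let ?S = "{y \<in> space (\<Pi>\<^sub>M i\<in>{1..n}. borel). Q y}"
      have "?S \<in> sets (\<Pi>\<^sub>M i\<in>{1..n}. borel)" using that by measurable
      from emeasure_distr[OF X this]
      have "emeasure (sample_law n h) ?S = emeasure M (?X -` ?S \<inter> space M)" unfolding law .
      moreover have "?X -` ?S \<inter> space M = {\<omega> \<in> space M. Q (?X \<omega>)}" by (auto simp: space_PiM PiE_iff)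
      moreover have "space (sample_law n h) = space (\<Pi>\<^sub>M i\<in>{1..n}. borel)" unfolding law[symmetric] by simp
      ultimately show ?thesis by simp
    qed
    show ?thesis
      unfolding indep_var_iff_emeasure[OF \<open>random_variable borel U\<close> \<open>random_variable borel V\<close>]
      unfolding U_eq V_eq
    proof (intro ball_cong refl)
      fix S B :: "real set" assume [measurable]: "S \<in> sets borel" "B \<in> sets borel"
      let ?law = "\<lambda>Q. emeasure (sample_law n h) {y \<in> space (sample_law n h). Q y}"
      let ?prob = "\<lambda>Q. emeasure M {\<omega> \<in> space M. Q (?X \<omega>)}"
      let ?m = "\<lambda>y. sample_mean n y \<in> S" and ?r = "\<lambda>y. root_Z_over_mean n A y \<in> B"
      have "?law (\<lambda>y. ?m y \<and> ?r y) = ?prob (\<lambda>y. ?m y \<and> ?r y)" by (rule em) measurable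
      moreover have "?law ?m = ?prob ?m" by (rule em) measurable
      moreover have "?law ?r = ?prob ?r" by (rule em) measurable
      ultimately show "(?prob (\<lambda>y. ?m y \<and> ?r y) = ?prob ?m * ?prob ?r) =
          (?law (\<lambda>y. ?m y \<and> ?r y) = ?law ?m * ?law ?r)"
        by (simp only:)
    qed
  qed
  \<comment> \<open>The values of \<open>f\<close> on the negative half-line matter only up to a null set; setting them to 0
    lets the bounds on the density hold pointwise.\<close>
  define g where "g x = (if x > 0 then f x else 0)" for x
  have g: "g \<in> borel_measurable borel" "\<And>x. g x \<ge> 0" "\<And>x. x > 0 \<Longrightarrow> g x > 0" "\<And>x. x \<le> 0 \<Longrightarrow> g x = 0"
    using assms(6,7,9) by (auto simp: g_def[abs_def])
  have "continuous_on {0<..} g \<longleftrightarrow> continuous_on {0<..} f"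
    by (intro continuous_on_cong) (auto simp: g_def)
  hence cont: "continuous_on {0<..} g" using assms(10) by simp
  have "AE x in F. x > 0"
    using assms(5)[of 1] n0 rv[of 1] by (subst assms(4)[of 1, symmetric]) (auto simp: AE_distr_iff)
  hence "AE x in lborel. f x > 0 \<longrightarrow> x > 0"
    unfolding assms(8) using assms(6) by (subst (asm) AE_density) auto
  hence "AE x in lborel. ennreal (f x) = ennreal (g x)"
    by eventually_elim (use assms(7) in \<open>auto simp: g_def order_less_le\<close>)
  hence F_g: "F = density lborel g"
    unfolding assms(8) using assms(6) g(1) by (intro density_cong) auto
  have law: "distr M (\<Pi>\<^sub>M i\<in>{1..n}. borel) ?X = sample_law n g" and prob_g: "prob_space (density lborel g)"
    using distr_iid_sample[OF assms(1) n0 assms(3), of g] assms(4) F_g g(1)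
    by auto
  have prob_law: "prob_space (sample_law n g)" unfolding law[symmetric] using X by (rule prob_space_distr)
  have "indep_var borel U borel V \<longleftrightarrow> gamma_distribution F"
  proof
    assume "indep_var borel U borel V"
    hence indep: "\<And>S B. S \<in> sets borel \<Longrightarrow> B \<in> sets borel \<Longrightarrow>
      emeasure (sample_law n g) {y \<in> space (sample_law n g). sample_mean n y \<in> S \<and> root_Z_over_mean n A y \<in> B} =
      emeasure (sample_law n g) {y \<in> space (sample_law n g). sample_mean n y \<in> S} *
      emeasure (sample_law n g) {y \<in> space (sample_law n g). root_Z_over_mean n A y \<in> B}"
      using transfer[OF law] by blast
    have "\<exists>a b c. \<forall>x>0. ln (g x) = a * ln x + b * x + c"
    proof (rule log_affine_if_touching_exponents_ordered)
      show "continuous_on {0<..} (\<lambda>x. ln (g x))"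
        using cont g(3) by (intro continuous_on_ln) force+
      show "a \<le> b" if "touched_above (\<lambda>x. ln (g x)) a" "touched_above (\<lambda>x. - ln (g x)) (- b)" for a b
        by (rule touching_exponents_ordered_if_independent[OF n2 assms(11) g(1,2,4,3) cont prob_law indep that])
    qed
    thus "gamma_distribution F"
      unfolding F_g using gamma_distribution_if_log_affine[OF g(1,3,4) prob_g] by blast
  next
    assume "gamma_distribution F"
    then obtain a b where ab: "a > 0" "b > 0" and F: "F = density lborel (\<lambda>x. ennreal (gamma_density a b x))"
      unfolding gamma_distribution_def by blast
    have law: "distr M (\<Pi>\<^sub>M i\<in>{1..n}. borel) ?X = sample_law n (gamma_density a b)"
      using distr_iid_sample(1)[OF assms(1) n0 assms(3), of "gamma_density a b"] assms(4) F
      by auto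
    have "prob_space (sample_law n (gamma_density a b))"
      unfolding law[symmetric] using X by (rule prob_space_distr)
    thus "indep_var borel U borel V"
      unfolding transfer[OF law] sample_law_def
      using gamma_product_independent[OF n0 ab] by blast
  qed
  thus ?thesis unfolding U_def V_def .
qed

end
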